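(* One can reconstruct the shape of a triangle $P$ from its bounce spectrum $B(P)$.
   Context: The three edges of the triangle $P$ carry distinct labels from an alphabet $\mathcal{A}$. The shape of a triangle means the triangle up to similarity. A billiard trajectory moves along straight lines in $P$ and reflects optically (angle of incidence equals angle of reflection) at edges; it is singular if it ever hits a vertex. The bounce sequence of a nonsingular bi-infinite basepointed trajectory is the $\mathbb{Z}$-indexed sequence of labels of the edges it hits, and the bounce spectrum $B(P)\subset\mathcal{A}^{\mathbb{Z}}$ is the set of bounce sequences of all nonsingular trajectories on $P$. "Reconstruct from $B(P)$" means that there is a method which, using only the information contained in the set $B(P)$ (and no other knowledge of $P$), recovers the shape of $P$; it is not claimed that the method is effective (e.g. a finite computation). *)

theory Defs
  imports "HOL-Analysis.Analysis"
begin

(* Vertices and edges are indexed by the ring of integers mod 3, so that edge i is the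
   side opposite vertex i. *)

record 'a triangle =
  vertex :: "3 \<Rightarrow> real ^ 2"
  edge_label :: "3 \<Rightarrow> 'a"

definition labelled_triangle :: "'a triangle \<Rightarrow> bool" where
  "labelled_triangle P \<longleftrightarrow> \<not> collinear (range (vertex P)) \<and> inj (edge_label P)"

definition region :: "'a triangle \<Rightarrow> (real ^ 2) set" where
  "region P = convex hull (range (vertex P))"

definition edge :: "'a triangle \<Rightarrow> 3 \<Rightarrow> (real ^ 2) set" where
  "edge P i = closed_segment (vertex P (i + 1)) (vertex P (i + 2))"

definition edge_direction :: "'a triangle \<Rightarrow> 3 \<Rightarrow> real ^ 2" where
  "edge_direction P i = vertex P (i + 2) - vertex P (i + 1)"

(* The linear reflection in the line spanned by w (for w nonzero): the component along w is
   kept, the orthogonal one is negated. *)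

definition reflect_along :: "real ^ 2 \<Rightarrow> real ^ 2 \<Rightarrow> real ^ 2" where
  "reflect_along w u = (2 * (u \<bullet> w) / (w \<bullet> w)) *\<^sub>R w - u"

(* A bi-infinite unit-speed trajectory with basepoint g 0. At each time s the incoming velocity
   u and the outgoing velocity v agree at interior points of the table and are related by the
   optical law at edges. Sliding along an edge needs no separate exclusion: it would reach a
   vertex. *)

definition nonsingular_trajectory :: "'a triangle \<Rightarrow> (real \<Rightarrow> real ^ 2) \<Rightarrow> bool" where
  "nonsingular_trajectory P g \<longleftrightarrow>
     (\<forall>s. g s \<in> region P \<and> g s \<notin> range (vertex P)) \<and>
     (\<forall>s. \<exists>u v. norm u = 1 \<and> norm v = 1 \<and>
        (\<forall>\<^sub>F h in at_right 0. g (s - h) = g s - h *\<^sub>R u \<and> g (s + h) = g s + h *\<^sub>R v) \<and>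
        (g s \<in> interior (region P) \<longrightarrow> v = u) \<and>
        (\<forall>i. g s \<in> edge P i \<longrightarrow> v = reflect_along (edge_direction P i) u))"

(* t enumerates all hitting times in increasing order; index 0 is the first hit at or after the
   basepoint. Another choice of indexing convention would give the same bounce spectrum, since
   the basepoint may be moved along the trajectory. *)

definition is_bounce_sequence :: "'a triangle \<Rightarrow> (real \<Rightarrow> real ^ 2) \<Rightarrow> (int \<Rightarrow> 'a) \<Rightarrow> bool" where
  "is_bounce_sequence P g b \<longleftrightarrow>
     (\<exists>t :: int \<Rightarrow> real. strict_mono t \<and> range t = {s. g s \<in> frontier (region P)} \<and>
        t (- 1) < 0 \<and> 0 \<le> t 0 \<and>
        (\<forall>n. \<exists>i. g (t n) \<in> edge P i \<and> b n = edge_label P i))"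

definition bounce_spectrum :: "'a triangle \<Rightarrow> (int \<Rightarrow> 'a) set" where
  "bounce_spectrum P = {b. \<exists>g. nonsingular_trajectory P g \<and> is_bounce_sequence P g b}"

(* Similarities of the plane, orientation-reversing ones included. *)

definition similarity :: "(real ^ 2 \<Rightarrow> real ^ 2) \<Rightarrow> bool" where
  "similarity f \<longleftrightarrow> (\<exists>c>0. \<forall>x y. dist (f x) (f y) = c * dist x y)"

(* The similarity class of the triangle as a plane figure, forgetting the labels. *)

definition shape :: "'a triangle \<Rightarrow> (real ^ 2) set set" where
  "shape P = {f ` region P | f. similarity f}"

end

theory Submission
  imports Defs
begin

text \<open>
Each angle of the triangle is a rotation number that can be read off from the bounce spectrum.
Fix a corner \<open>c\<close> with angle \<open>\<theta>\<close> and a generic ray leaving \<open>c\<close> at angle \<open>s\<close> from one of its sides.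
A trajectory that comes in along this ray and misses \<open>c\<close> by very little bounces \<open>k\<close> times alternately
on the two sides and then leaves along the ray at angle \<open>s + k \<theta> - \<pi>\<close> from the appropriate side, because it
turns by exactly \<open>\<pi>\<close> around \<open>c\<close> in the unfolding. Chaining such trajectories along the rays
\<open>s\<^sub>i = s\<^sub>0 + (k\<^sub>0 + \<dots> + k\<^sub>i\<^sub>-\<^sub>1) \<theta> - i \<pi>\<close> produces, for every \<open>N\<close>, a list of bounce sequences in which the \<open>N\<close> letters
after each fan coincide with the reversed \<open>N\<close> letters before the next one.

Suppose another triangle realizes the same sequences. Two trajectories that share \<open>N\<close> letters unfold to
segments crossing the same long chain of triangles, so their directions agree up to \<open>O(1/N)\<close>. Hence the
same chain relation holds in the other triangle, up to an error that tends to \<open>0\<close> with \<open>N\<close>, and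
\<open>(k\<^sub>0 + \<dots> + k\<^sub>n\<^sub>-\<^sub>1) \<theta>' - n \<pi>\<close> stays bounded as well, which forces \<open>\<theta>' = \<theta>\<close>.
\<close>

text \<open>The generic ray at a corner is not itself a trajectory, so only its finite initial words
  are available: hitting an open edge is stable under small displacements, following an infinite
  word is not. This is why the comparison must tolerate an error and why the order of choices
  matters. The rays and the numbers \<open>k\<close> are fixed once, for all \<open>N\<close>; then
  \<open>N\<close> tends to infinity while \<open>n\<close> is fixed, which removes the accumulated
  error; only then does \<open>n\<close> grow. The initial angle avoids countably many values, so
  that no ray of the chain runs into a vertex or along a side. A second obstacle is that the other
  triangle may attach its labels to its indices in another order. Every trajectory hits all three
  edges, so each label of the first triangle is a label of the second, and a permutation of the
  indices makes the labellings equal. The angles can then be compared corner by corner. The recovery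
  map itself is a mere choice of some triangle with the given spectrum.\<close>

lemma three_cases: "a \<noteq> b \<Longrightarrow> b \<noteq> c \<Longrightarrow> a \<noteq> c \<Longrightarrow> d = a \<or> d = b \<or> d = (c::3)"
  by (metis exhaust_3)

lemma three_UNIV: "a \<noteq> b \<Longrightarrow> b \<noteq> c \<Longrightarrow> a \<noteq> c \<Longrightarrow> (UNIV :: 3 set) = {a, b, c}"
  using three_cases by blast

lemma three_shift: "(a::3) + 1 \<noteq> a" "a + 2 \<noteq> a" "a + 1 \<noteq> a + 2"
  by (auto simp: add_eq_0_iff)

text \<open>The indices of the three edges add up to \<open>0\<close>, so this is the third index besides \<open>c\<close> and \<open>a\<close>,
that is, the other edge at the corner \<open>c\<close>.\<close>

definition other :: "3 \<Rightarrow> 3 \<Rightarrow> 3" where "other c a = - (c + a)"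

lemma other_other [simp]: "other c (other c a) = a"
  by (simp add: other_def)

lemma other_shift: "other c (c + 1) = c + 2" "other c (c + 2) = c + 1"
proof -
  have "(3::3) = 0" by simp
  have "other c (c + 1) - (c + 2) = - (3 * c) - 3" by (simp add: other_def algebra_simps)
  then show "other c (c + 1) = c + 2" using \<open>(3::3) = 0\<close> by (metis add.right_neutral diff_0 diff_eq_diff_eq diff_self mult_zero_left minus_zero)
  then show "other c (c + 2) = c + 1" by (metis other_other)
qed

lemma other_neq: assumes "a \<noteq> c" shows "other c a \<noteq> a" "other c a \<noteq> c"
proof -
  have "a = c + 1 \<or> a = c + 2" using three_cases[of c "c+1" "c+2" a] three_shift[of c] assms by metis
  then show "other c a \<noteq> a" "other c a \<noteq> c" using other_shift three_shift[of c] by metis+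
qed

lemma other_eqI: "a \<noteq> c \<Longrightarrow> b \<noteq> c \<Longrightarrow> a \<noteq> b \<Longrightarrow> other c a = b"
  using other_neq three_cases by metis

section \<open>Orthonormal coordinates in the plane\<close>

lemma plane_expand:
  fixes e n x :: "real ^ 2"
  assumes "norm e = 1" "norm n = 1" "e \<bullet> n = 0"
  shows "x = (x \<bullet> e) *\<^sub>R e + (x \<bullet> n) *\<^sub>R n"
proof -
  have ind: "independent {e, n}" and ne: "e \<noteq> n"
  proof -
    show ne: "e \<noteq> n" using assms by auto
    have "pairwise orthogonal {e, n}" using assms by (auto simp: pairwise_def orthogonal_def inner_commute)
    moreover have "0 \<notin> {e, n}" using assms by auto
    ultimately show "independent {e, n}" by (rule pairwise_orthogonal_independent)
  qed
  have "(UNIV :: (real ^ 2) set) \<subseteq> span {e, n}"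
    by (rule card_ge_dim_independent) (use ind ne in auto)
  then have "x \<in> span {e, n}" by blast
  then obtain \<alpha> where "x - \<alpha> *\<^sub>R e \<in> span {n}" by (auto simp: span_breakdown_eq)
  then obtain \<beta> where "x - \<alpha> *\<^sub>R e = \<beta> *\<^sub>R n" by (auto simp: span_singleton)
  then have x: "x = \<alpha> *\<^sub>R e + \<beta> *\<^sub>R n" by (simp add: algebra_simps)
  have "e \<bullet> e = 1" "n \<bullet> n = 1" "n \<bullet> e = 0" using assms by (auto simp: dot_square_norm inner_commute)
  then show ?thesis using assms(3) unfolding x by (simp add: inner_left_distrib inner_right_distrib)
qed

lemma plane_parseval:
  fixes e n x :: "real ^ 2"
  assumes "norm e = 1" "norm n = 1" "e \<bullet> n = 0"
  shows "(norm x)\<^sup>2 = (x \<bullet> e)\<^sup>2 + (x \<bullet> n)\<^sup>2"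
proof -
  have "x \<bullet> x = x \<bullet> ((x \<bullet> e) *\<^sub>R e + (x \<bullet> n) *\<^sub>R n)" using plane_expand[OF assms, of x] by metis
  then show ?thesis by (simp add: inner_right_distrib power2_norm_eq_inner power2_eq_square[of "_ \<bullet> _"])
qed

lemma orth_part: fixes u w :: "'b::real_inner" shows "(u - ((u \<bullet> w) / (w \<bullet> w)) *\<^sub>R w) \<bullet> w = 0"
  by (cases "w = 0") (simp_all add: inner_diff_left)

section \<open>Angles and unit vectors at a corner\<close>

locale billiard_triangle =
  fixes V :: "3 \<Rightarrow> real ^ 2"
  assumes noncollinear: "\<not> collinear (range V)"
begin

text \<open>One Gram-Schmidt step applied to the vector towards the opposite vertex: the result
  points into the triangle for either orientation, so no rotation by a right angle and no sign
  convention enters.\<close>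

definition inward_normal :: "3 \<Rightarrow> real ^ 2" where
  "inward_normal a = (let w = V (a + 2) - V (a + 1); u = V a - V (a + 1) in sgn (u - ((u \<bullet> w) / (w \<bullet> w)) *\<^sub>R w))"

text \<open>Up to the factor \<open>signed_dist a (V a)\<close> this is the barycentric coordinate
  of the vertex \<open>a\<close>. The signs of these three functions describe the triangle, its
  interior and its edges.\<close>

definition signed_dist :: "3 \<Rightarrow> real ^ 2 \<Rightarrow> real" where
  "signed_dist a x = inward_normal a \<bullet> (x - V (a + 1))"

definition open_edge :: "3 \<Rightarrow> real ^ 2 \<Rightarrow> bool" where
  "open_edge a x \<longleftrightarrow> signed_dist a x = 0 \<and> (\<forall>b. b \<noteq> a \<longrightarrow> 0 < signed_dist b x)"

definition reflect :: "3 \<Rightarrow> real ^ 2 \<Rightarrow> real ^ 2" where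
  "reflect a u = u - (2 * (u \<bullet> inward_normal a)) *\<^sub>R inward_normal a"

text \<open>Edge \<open>a\<close> joins the vertices \<open>c\<close> and \<open>other c a\<close> when \<open>a \<noteq> c\<close>.\<close>

definition ray :: "3 \<Rightarrow> 3 \<Rightarrow> real ^ 2" where
  "ray c a = sgn (V (other c a) - V c)"

definition ang :: "3 \<Rightarrow> real" where
  "ang c = arccos (ray c (c + 1) \<bullet> ray c (c + 2))"

text \<open>The unit vector at angle \<open>\<tau>\<close> from edge \<open>a\<close> at the corner \<open>c\<close>, measured towards the triangle;
this convention makes the formulas independent of the orientation.\<close>

definition dir :: "3 \<Rightarrow> 3 \<Rightarrow> real \<Rightarrow> real ^ 2" where
  "dir c a \<tau> = cos \<tau> *\<^sub>R ray c a + sin \<tau> *\<^sub>R inward_normal a"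

lemma noncollinear3: assumes "a \<noteq> b" "b \<noteq> c" "a \<noteq> c" shows "\<not> collinear {V a, V b, V c}"
  using noncollinear three_UNIV[OF assms] by (metis image_insert image_empty)

lemma V_neq: assumes "a \<noteq> b" shows "V a \<noteq> V b"
  using noncollinear3[of a b "other a b"] other_neq[of b a] assms by (metis collinear_2 insert_absorb2)

lemma inward_normal_orth0: "inward_normal a \<bullet> (V (a + 2) - V (a + 1)) = 0"
  using orth_part[of "V a - V (a + 1)" "V (a + 2) - V (a + 1)"]
  by (simp only: inward_normal_def Let_def sgn_div_norm inner_scaleR_left mult_zero_right)

lemma inward_normal_foot_neq:
  assumes "w = V (a + 2) - V (a + 1)" "u = V a - V (a + 1)"
  shows "u - ((u \<bullet> w) / (w \<bullet> w)) *\<^sub>R w \<noteq> 0"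
proof
  assume "u - ((u \<bullet> w) / (w \<bullet> w)) *\<^sub>R w = 0"
  then have "u = ((u \<bullet> w) / (w \<bullet> w)) *\<^sub>R w" by simp
  then obtain r where "u = r *\<^sub>R w" by blast
  then have "V a = r *\<^sub>R V (a + 2) + (1 - r) *\<^sub>R V (a + 1)" by (simp add: assms algebra_simps)
  then have "collinear {V (a+1), V a, V (a+2)}" by (subst insert_commute, subst (2) insert_commute) (metis collinear_3_expand insert_commute)
  then show False using noncollinear3[of "a+1" a "a+2"] three_shift[of a] by metis
qed

lemma norm_inward_normal [simp]: "norm (inward_normal a) = 1"
  using inward_normal_foot_neq[OF refl refl, of a] by (simp add: inward_normal_def Let_def norm_sgn)

lemma inward_normal_inward_normal [simp]: "inward_normal a \<bullet> inward_normal a = 1"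
  by (simp add: dot_square_norm)

lemma signed_dist_self_pos: "0 < signed_dist a (V a)"
proof -
  define w where "w = V (a + 2) - V (a + 1)"
  define u where "u = V a - V (a + 1)"
  define z where "z = u - ((u \<bullet> w) / (w \<bullet> w)) *\<^sub>R w"
  have z: "z \<noteq> 0" using inward_normal_foot_neq[OF w_def u_def] by (simp add: z_def)
  have n: "inward_normal a = sgn z" by (simp add: inward_normal_def Let_def z_def u_def w_def)
  have "z \<bullet> w = 0" unfolding z_def by (rule orth_part)
  then have "z \<bullet> u = z \<bullet> z" by (simp add: z_def inner_diff_right)
  then have "z \<bullet> u > 0" using z by simp
  then show ?thesis using z by (simp add: signed_dist_def n sgn_div_norm u_def[symmetric])
qed

lemma signed_dist_other [simp]: assumes "b \<noteq> a" shows "signed_dist a (V b) = 0"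
proof -
  have "b = a + 1 \<or> b = a + 2" using three_cases[of a "a+1" "a+2" b] three_shift[of a] assms by metis
  then show ?thesis using inward_normal_orth0[of a] by (auto simp: signed_dist_def)
qed

lemma signed_dist_add: "signed_dist a (x + y) = signed_dist a x + inward_normal a \<bullet> y"
  by (simp add: signed_dist_def algebra_simps)

lemma signed_dist_diff: "signed_dist a x - signed_dist a y = inward_normal a \<bullet> (x - y)"
  by (simp add: signed_dist_def algebra_simps)

lemma inward_normal_V_diff: "b \<noteq> a \<Longrightarrow> c \<noteq> a \<Longrightarrow> inward_normal a \<bullet> (V b - V c) = 0"
  by (simp add: signed_dist_diff[symmetric])

lemma norm_ray [simp]: assumes "a \<noteq> c" shows "norm (ray c a) = 1"
  using V_neq[of "other c a" c] other_neq[OF assms] by (simp add: ray_def norm_sgn)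

lemma ray_scale: "a \<noteq> c \<Longrightarrow> V (other c a) = V c + norm (V (other c a) - V c) *\<^sub>R ray c a"
  using V_neq[of "other c a" c] other_neq[of a c] by (simp add: ray_def sgn_div_norm)

lemma ray_orth: assumes "a \<noteq> c" shows "ray c a \<bullet> inward_normal a = 0"
  using inward_normal_V_diff[of "other c a" a c] other_neq[OF assms] assms
  by (simp add: ray_def sgn_div_norm inner_commute)

lemma inward_normal_other_ray_pos: assumes "a \<noteq> c" shows "0 < inward_normal (other c a) \<bullet> ray c a"
proof -
  have "0 < signed_dist (other c a) (V (other c a)) - signed_dist (other c a) (V c)"
    using signed_dist_self_pos other_neq[OF assms] by (simp add: signed_dist_other)
  then have "0 < inward_normal (other c a) \<bullet> (V (other c a) - V c)" by (simp add: signed_dist_diff)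
  then show ?thesis using V_neq[of "other c a" c] other_neq[OF assms] by (simp add: ray_def sgn_div_norm)
qed

lemma ang_eq: assumes "a \<noteq> c" shows "ang c = arccos (ray c a \<bullet> ray c (other c a))"
proof -
  have "a = c + 1 \<or> a = c + 2" using three_cases[of c "c+1" "c+2" a] three_shift[of c] assms by metis
  then show ?thesis using other_shift by (auto simp: ang_def inner_commute)
qed

text \<open>In the frame of edge \<open>a\<close> the other side has a positive second coordinate,
  which is therefore the nonnegative root of \<open>1 - \<alpha>\<^sup>2\<close>, that is, the sine
  of the \<open>arccos\<close>.\<close>

lemma ray_other:
  assumes "a \<noteq> c"
  shows "ray c (other c a) = cos (ang c) *\<^sub>R ray c a + sin (ang c) *\<^sub>R inward_normal a" and "0 < ang c" and "ang c < pi"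
proof -
  let ?b = "other c a"
  have b: "?b \<noteq> c" using other_neq[OF assms] by simp
  define \<alpha> where "\<alpha> = ray c ?b \<bullet> ray c a"
  define \<beta> where "\<beta> = ray c ?b \<bullet> inward_normal a"
  have e: "ray c ?b = \<alpha> *\<^sub>R ray c a + \<beta> *\<^sub>R inward_normal a"
    unfolding \<alpha>_def \<beta>_def by (rule plane_expand) (use assms ray_orth in auto)
  have "(norm (ray c ?b))\<^sup>2 = \<alpha>\<^sup>2 + \<beta>\<^sup>2"
    unfolding \<alpha>_def \<beta>_def by (rule plane_parseval) (use assms ray_orth in auto)
  then have sq: "\<alpha>\<^sup>2 + \<beta>\<^sup>2 = 1" using b by simp
  have \<beta>: "0 < \<beta>" using inward_normal_other_ray_pos[OF b] by (simp add: \<beta>_def inner_commute)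
  then have "\<alpha>\<^sup>2 < 1" using sq by (smt (verit) zero_less_power)
  then have a1: "-1 < \<alpha>" "\<alpha> < 1" by (auto simp: power2_less_1_iff abs_less_iff abs_square_less_1)
  have t: "ang c = arccos \<alpha>" using ang_eq[OF assms] by (simp add: \<alpha>_def inner_commute)
  have c: "cos (ang c) = \<alpha>" using a1 t by simp
  have "sin (ang c) = sqrt (1 - \<alpha>\<^sup>2)" using a1 t by (simp add: sin_arccos)
  then have "sin (ang c) = \<beta>" using sq \<beta> by (smt (verit) real_sqrt_unique)
  then show "ray c ?b = cos (ang c) *\<^sub>R ray c a + sin (ang c) *\<^sub>R inward_normal a" using e c by simp
  show "0 < ang c" "ang c < pi" using a1 t arccos_lt_bounded by auto
qed

lemma ang_bounds: "0 < ang c" "ang c < pi"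
  using ray_other[of "c + 1" c] three_shift by metis+

text \<open>This is \<open>ray_other\<close> with the two sides exchanged, solved for the normal;
  the angle is the same seen from either side and its sine is nonzero.\<close>

lemma inward_normal_other:
  assumes "a \<noteq> c"
  shows "inward_normal (other c a) = sin (ang c) *\<^sub>R ray c a - cos (ang c) *\<^sub>R inward_normal a"
proof -
  let ?b = "other c a"
  have b: "?b \<noteq> c" using other_neq[OF assms] by simp
  have s: "sin (ang c) > 0" using ang_bounds[of c] by (simp add: sin_gt_zero)
  have "ray c a = cos (ang c) *\<^sub>R ray c ?b + sin (ang c) *\<^sub>R inward_normal ?b" using ray_other(1)[OF b] by simp
  then have "sin (ang c) *\<^sub>R inward_normal ?b = ray c a - cos (ang c) *\<^sub>R ray c ?b" by (simp add: algebra_simps)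
  also have "\<dots> = (1 - (cos (ang c))\<^sup>2) *\<^sub>R ray c a - (cos (ang c) * sin (ang c)) *\<^sub>R inward_normal a"
    unfolding ray_other(1)[OF assms] by (simp add: algebra_simps power2_eq_square)
  also have "\<dots> = sin (ang c) *\<^sub>R (sin (ang c) *\<^sub>R ray c a - cos (ang c) *\<^sub>R inward_normal a)"
    by (simp only: sin_squared_eq[symmetric]) (simp add: algebra_simps power2_eq_square)
  finally show ?thesis using s by (metis real_vector.scale_left_imp_eq less_irrefl)
qed

text \<open>Both sides measure angles towards the triangle, so the two readings of one vector add up
  to \<open>ang c\<close>. Combined with \<open>reflect_dir\<close> this yields the turn by
  \<open>ang c\<close> at each bounce near the corner.\<close>

lemma dir_other: assumes "a \<noteq> c" shows "dir c (other c a) (ang c - \<tau>) = dir c a \<tau>"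
proof -
  let ?t = "ang c"
  have "dir c (other c a) (?t - \<tau>) = (cos (?t - \<tau>) * cos ?t + sin (?t - \<tau>) * sin ?t) *\<^sub>R ray c a
      + (cos (?t - \<tau>) * sin ?t - sin (?t - \<tau>) * cos ?t) *\<^sub>R inward_normal a"
    unfolding dir_def ray_other(1)[OF assms] inward_normal_other[OF assms] by (simp add: algebra_simps)
  also have "cos (?t - \<tau>) * cos ?t + sin (?t - \<tau>) * sin ?t = cos ((?t - \<tau>) - ?t)" by (simp only: cos_diff)
  also have "cos (?t - \<tau>) * sin ?t - sin (?t - \<tau>) * cos ?t = sin (?t - (?t - \<tau>))"
    by (simp only: sin_diff) (simp add: algebra_simps)
  finally show ?thesis by (simp add: dir_def)
qed

lemma inward_normal_dir: "a \<noteq> c \<Longrightarrow> inward_normal a \<bullet> dir c a \<tau> = sin \<tau>"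
  using ray_orth by (simp add: dir_def inner_right_distrib inner_commute)

lemma inward_normal_other_dir: "a \<noteq> c \<Longrightarrow> inward_normal (other c a) \<bullet> dir c a \<tau> = sin (ang c - \<tau>)"
  using inward_normal_dir[of "other c a" c "ang c - \<tau>"] by (simp add: dir_other other_neq)

lemma norm_dir [simp]: assumes "a \<noteq> c" shows "norm (dir c a \<tau>) = 1"
proof -
  have "(norm (dir c a \<tau>))\<^sup>2 = (dir c a \<tau> \<bullet> ray c a)\<^sup>2 + (dir c a \<tau> \<bullet> inward_normal a)\<^sup>2"
    by (rule plane_parseval) (use assms ray_orth in auto)
  also have "\<dots> = (cos \<tau>)\<^sup>2 + (sin \<tau>)\<^sup>2"
    using assms ray_orth[OF assms] norm_ray[OF assms]
    by (simp add: dir_def inner_left_distrib inner_commute[of "inward_normal a"] dot_square_norm)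
  also have "\<dots> = 1" by simp
  finally show ?thesis by (smt (verit) norm_ge_zero power2_eq_1_iff)
qed

lemma reflect_dir: "a \<noteq> c \<Longrightarrow> reflect a (dir c a \<tau>) = dir c a (- \<tau>)"
  by (simp add: reflect_def inner_commute[of _ "inward_normal a"] inward_normal_dir) (simp add: dir_def scaleR_diff_left[symmetric] add_diff_eq[symmetric])

lemma reflect_other_dir: "a \<noteq> c \<Longrightarrow> reflect (other c a) (dir c a \<tau>) = dir c (other c a) (\<tau> - ang c)"
  using reflect_dir[of "other c a" c "ang c - \<tau>"] by (simp add: dir_other other_neq)

lemma minus_dir: "- dir c a \<tau> = dir c a (\<tau> - pi)"
  by (simp add: dir_def cos_diff sin_diff)

lemma dir_exists:
  assumes "a \<noteq> c" "norm v = 1" "0 < inward_normal a \<bullet> v"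
  obtains \<tau> where "0 < \<tau>" "\<tau> < pi" "v = dir c a \<tau>"
proof -
  define \<alpha> where "\<alpha> = v \<bullet> ray c a"
  define \<beta> where "\<beta> = v \<bullet> inward_normal a"
  have e: "v = \<alpha> *\<^sub>R ray c a + \<beta> *\<^sub>R inward_normal a"
    unfolding \<alpha>_def \<beta>_def by (rule plane_expand) (use assms ray_orth in auto)
  have "(norm v)\<^sup>2 = \<alpha>\<^sup>2 + \<beta>\<^sup>2"
    unfolding \<alpha>_def \<beta>_def by (rule plane_parseval) (use assms ray_orth in auto)
  then have sq: "\<alpha>\<^sup>2 + \<beta>\<^sup>2 = 1" using assms by simp
  have \<beta>: "0 < \<beta>" using assms by (simp add: \<beta>_def inner_commute)
  then have "\<alpha>\<^sup>2 < 1" using sq by (smt (verit) zero_less_power)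
  then have a1: "-1 < \<alpha>" "\<alpha> < 1" by (auto simp: abs_less_iff abs_square_less_1)
  have "sin (arccos \<alpha>) = \<beta>" using a1 sq \<beta> by (smt (verit) real_sqrt_unique sin_arccos)
  then have "v = dir c a (arccos \<alpha>)" using e a1 by (simp add: dir_def)
  then show thesis using that a1 arccos_lt_bounded by blast
qed

text \<open>The chord of an arc of the unit circle; it translates closeness of velocities into
  closeness of angles.\<close>

lemma dir_dist: assumes "a \<noteq> c" shows "norm (dir c a \<tau> - dir c a \<sigma>) = 2 * \<bar>sin ((\<tau> - \<sigma>) / 2)\<bar>"
proof -
  have "(norm (dir c a \<tau> - dir c a \<sigma>))\<^sup>2
      = ((dir c a \<tau> - dir c a \<sigma>) \<bullet> ray c a)\<^sup>2 + ((dir c a \<tau> - dir c a \<sigma>) \<bullet> inward_normal a)\<^sup>2"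
    by (rule plane_parseval) (use assms ray_orth in auto)
  also have "\<dots> = (cos \<tau> - cos \<sigma>)\<^sup>2 + (sin \<tau> - sin \<sigma>)\<^sup>2"
    using assms ray_orth[OF assms] norm_ray[OF assms]
    by (simp add: dir_def inner_left_distrib inner_diff_left inner_commute[of "inward_normal a"] dot_square_norm)
  also have "\<dots> = 2 - 2 * cos (\<tau> - \<sigma>)"
    by (simp add: cos_diff power2_diff) (smt (verit) sin_cos_squared_add)
  also have "cos (\<tau> - \<sigma>) = 1 - 2 * (sin ((\<tau> - \<sigma>) / 2))\<^sup>2"
    using cos_double_sin[of "(\<tau> - \<sigma>) / 2"] by (simp del: distrib_left_numeral right_diff_distrib_numeral)
  also have "2 - 2 * (1 - 2 * (sin ((\<tau> - \<sigma>) / 2))\<^sup>2) = (2 * \<bar>sin ((\<tau> - \<sigma>) / 2)\<bar>)\<^sup>2"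
    by (simp add: power_mult_distrib)
  finally show ?thesis by (rule power2_eq_imp_eq) auto
qed

lemma reflect_reflect [simp]: "reflect a (reflect a u) = u"
  by (simp add: reflect_def inner_diff_left algebra_simps)

lemma reflect_minus: "reflect a (- u) = - reflect a u"
  by (simp add: reflect_def)

lemma norm_reflect [simp]: "norm (reflect a u) = norm u"
proof -
  have "reflect a u \<bullet> reflect a u = u \<bullet> u"
    by (simp add: reflect_def inner_diff_left inner_diff_right inner_commute)
  then show ?thesis by (simp add: norm_eq)
qed

lemma inward_normal_reflect: "inward_normal a \<bullet> reflect a u = - (inward_normal a \<bullet> u)"
  by (simp add: reflect_def inner_diff_right inner_commute)

lemma reflect_fixed: "inward_normal a \<bullet> u = 0 \<Longrightarrow> reflect a u = u"
  by (simp add: reflect_def inner_commute)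

text \<open>Keeping only the sign of the component along the edge amounts to negating the component
  along the normal; the direction in which the edge is traversed drops out.\<close>

lemma reflect_along_reflect:
  assumes "b \<noteq> a" "d \<noteq> a" "b \<noteq> d"
  shows "reflect_along (V b - V d) u = reflect a u"
proof -
  have a: "a \<noteq> d" using assms by simp
  have o: "other d a = b" using assms by (intro other_eqI) auto
  define l where "l = norm (V b - V d)"
  have l: "l > 0" using V_neq[OF assms(3)] by (simp add: l_def)
  have w: "V b - V d = l *\<^sub>R ray d a" using ray_scale[OF a] by (simp add: o l_def algebra_simps)
  have rr: "ray d a \<bullet> ray d a = 1" using a by (simp add: dot_square_norm)
  have "reflect_along (V b - V d) u = (2 * (u \<bullet> ray d a)) *\<^sub>R ray d a - u"
    using l by (simp add: reflect_along_def w rr)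
  also have "\<dots> = reflect a u"
  proof -
    have "u = (u \<bullet> ray d a) *\<^sub>R ray d a + (u \<bullet> inward_normal a) *\<^sub>R inward_normal a"
      by (rule plane_expand) (use a ray_orth in auto)
    then have "2 *\<^sub>R u = (2 * (u \<bullet> ray d a)) *\<^sub>R ray d a + (2 * (u \<bullet> inward_normal a)) *\<^sub>R inward_normal a"
      by (metis scaleR_add_right scaleR_scaleR)
    then show ?thesis by (simp add: reflect_def scaleR_2 algebra_simps)
  qed
  finally show ?thesis .
qed


section \<open>Trajectories as sequences of bounces\<close>

text \<open>Three noncollinear points span the plane affinely. Since \<open>signed_dist a\<close> is
  affine and vanishes at the two vertices other than \<open>a\<close>, it sees only the coefficient
  of \<open>V a\<close>.\<close>

lemma barycentric:
  obtains l :: "3 \<Rightarrow> real" where "(\<Sum>a\<in>UNIV. l a) = 1" "x = (\<Sum>a\<in>UNIV. l a *\<^sub>R V a)"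
    "\<And>a. signed_dist a x = l a * signed_dist a (V a)"
proof -
  have ne3: "(1::3) \<noteq> 2" "(2::3) \<noteq> 0" "(1::3) \<noteq> 0" by simp_all
  then have ne: "V 1 \<noteq> V 2" "V 2 \<noteq> V 0" "V 1 \<noteq> V 0" by (simp_all only: V_neq not_False_eq_True)
  have U: "(UNIV :: 3 set) = {1, 2, 0}" using three_UNIV[of 1 2 0] ne3 by blast
  have "affine hull {V 1, V 2, V 0} = UNIV"
  proof (rule affine_independent_span_eq)
    show "\<not> affine_dependent {V 1, V 2, V 0}"
      using noncollinear3[of 1 2 0] ne3 by (simp add: collinear_3_eq_affine_dependent)
    show "card {V 1, V 2, V 0} = Suc DIM(real ^ 2)" using ne by simp
  qed
  then have "x \<in> affine hull {V 1, V 2, V 0}" by blast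
  then obtain u v w where x: "x = u *\<^sub>R V 1 + v *\<^sub>R V 2 + w *\<^sub>R V 0" and uvw: "u + v + w = 1"
    unfolding affine_hull_3 by blast
  define l where "l = (\<lambda>a::3. if a = 1 then u else if a = 2 then v else w)"
  have l: "l 1 = u" "l 2 = v" "l 0 = w" using ne3 by (simp_all add: l_def)
  have s3: "(\<Sum>a\<in>UNIV. f a) = f 1 + (f 2 + f 0)" for f :: "3 \<Rightarrow> 'z::ab_group_add"
  proof -
    have "(\<Sum>a\<in>UNIV. f a) = (\<Sum>a\<in>{1, 2, 0}. f a)" by (simp only: U)
    also have "\<dots> = f 1 + (f 2 + f 0)"
      using ne3 by (subst sum.insert, simp, blast, subst sum.insert, simp, blast, simp)
    finally show ?thesis .
  qed
  have sum: "(\<Sum>a\<in>UNIV. l a) = 1" using uvw unfolding s3 l by simp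
  have xs: "x = (\<Sum>a\<in>UNIV. l a *\<^sub>R V a)" unfolding s3 l x by (simp add: add.assoc)
  have "signed_dist a x = l a * signed_dist a (V a)" for a
  proof -
    have "x - V (a + 1) = (\<Sum>b\<in>UNIV. l b *\<^sub>R V b) - (\<Sum>b\<in>UNIV. l b) *\<^sub>R V (a + 1)"
      by (simp add: xs sum)
    also have "\<dots> = (\<Sum>b\<in>UNIV. l b *\<^sub>R (V b - V (a + 1)))"
      by (simp add: scaleR_sum_left scaleR_diff_right sum_subtractf)
    finally have "signed_dist a x = (\<Sum>b\<in>UNIV. l b * signed_dist a (V b))"
      by (simp add: signed_dist_def inner_sum_right)
    also have "\<dots> = (\<Sum>b\<in>{a}. l b * signed_dist a (V b))"
      by (rule sum.mono_neutral_right) auto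
    finally show ?thesis by simp
  qed
  then show thesis using that sum xs by blast
qed

text \<open>A weighted Viviani theorem. It prevents a point from being close to all three edges at
  once, and its linear part is a positive relation between the three normals.\<close>

lemma signed_dist_sum: "(\<Sum>a\<in>UNIV. signed_dist a x / signed_dist a (V a)) = 1"
proof -
  obtain l where "(\<Sum>a\<in>UNIV. l a) = 1" "\<And>a. signed_dist a x = l a * signed_dist a (V a)" using barycentric[of x] by metis
  then show ?thesis using signed_dist_self_pos by (simp add: less_imp_neq[symmetric])
qed

lemma eq_by_signed_dist: assumes "\<And>a. signed_dist a x = signed_dist a y" shows "x = y"
proof -
  obtain l where l: "x = (\<Sum>a\<in>UNIV. l a *\<^sub>R V a)" "\<And>a. signed_dist a x = l a * signed_dist a (V a)" using barycentric[of x] by metis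
  obtain m where m: "y = (\<Sum>a\<in>UNIV. m a *\<^sub>R V a)" "\<And>a. signed_dist a y = m a * signed_dist a (V a)" using barycentric[of y] by metis
  have "l a = m a" for a using l(2)[of a] m(2)[of a] assms[of a] signed_dist_self_pos[of a] by simp
  then show ?thesis using l m by simp
qed

lemma in_region: "x \<in> convex hull range V \<longleftrightarrow> (\<forall>a. 0 \<le> signed_dist a x)"
proof
  assume "x \<in> convex hull range V"
  moreover have "convex hull range V \<subseteq> {x. 0 \<le> signed_dist a x}" for a
  proof (rule hull_minimal)
    show "range V \<subseteq> {x. 0 \<le> signed_dist a x}"
    proof
      fix x assume "x \<in> range V"
      then obtain b where "x = V b" by blast
      then show "x \<in> {x. 0 \<le> signed_dist a x}" using signed_dist_self_pos[of a] signed_dist_other[of b a] by (cases "b = a") auto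
    qed
    have "{x. 0 \<le> signed_dist a x} = {x. inward_normal a \<bullet> x \<ge> inward_normal a \<bullet> V (a + 1)}" by (auto simp: signed_dist_def inner_diff_right)
    then show "convex {x. 0 \<le> signed_dist a x}" by (simp add: convex_halfspace_ge)
  qed
  ultimately show "\<forall>a. 0 \<le> signed_dist a x" by blast
next
  assume p: "\<forall>a. 0 \<le> signed_dist a x"
  obtain l where l: "(\<Sum>a\<in>UNIV. l a) = 1" "x = (\<Sum>a\<in>UNIV. l a *\<^sub>R V a)" "\<And>a. signed_dist a x = l a * signed_dist a (V a)"
    using barycentric[of x] by metis
  have "0 \<le> l a" for a using p l(3)[of a] signed_dist_self_pos[of a] by (metis zero_le_mult_iff not_le)
  then show "x \<in> convex hull range V" unfolding l(2)
    by (intro convex_sum) (auto simp: l(1) hull_inc)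
qed

lemma in_interior: "x \<in> interior (convex hull range V) \<longleftrightarrow> (\<forall>a. 0 < signed_dist a x)"
proof
  assume "x \<in> interior (convex hull range V)"
  then obtain e where e: "e > 0" "cball x e \<subseteq> convex hull range V" by (meson mem_interior_cball)
  show "\<forall>a. 0 < signed_dist a x"
  proof
    fix a
    have "x - e *\<^sub>R inward_normal a \<in> cball x e" using e by (simp add: dist_norm)
    then have "0 \<le> signed_dist a (x - e *\<^sub>R inward_normal a)" using e in_region by blast
    then show "0 < signed_dist a x" using e(1) signed_dist_diff[of a "x - e *\<^sub>R inward_normal a" x] by simp
  qed
next
  assume p: "\<forall>a. 0 < signed_dist a x"
  have op: "open {x. \<forall>a. 0 < signed_dist a x}"
  proof -
    have "open {x. 0 < signed_dist a x}" for a
      unfolding signed_dist_def by (intro open_Collect_less continuous_intros)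
    then have "open (\<Inter>a. {x. 0 < signed_dist a x})" by (intro open_INT) auto
    moreover have "(\<Inter>a. {x. 0 < signed_dist a x}) = {x. \<forall>a. 0 < signed_dist a x}" by auto
    ultimately show ?thesis by simp
  qed
  have "{x. \<forall>a. 0 < signed_dist a x} \<subseteq> convex hull range V" using in_region less_imp_le by blast
  then show "x \<in> interior (convex hull range V)" using p op interior_maximal by blast
qed

lemma frontier_region: "frontier (convex hull range V) = convex hull range V - interior (convex hull range V)"
  by (simp add: frontier_def closure_closed compact_imp_closed compact_convex_hull finite_imp_compact)

lemma open_edge_frontier: "open_edge a x \<Longrightarrow> x \<in> frontier (convex hull range V)"
  unfolding frontier_region open_edge_def Diff_iff in_region in_interior by (metis less_eq_real_def less_irrefl)

lemma not_vertexI: "open_edge a x \<Longrightarrow> x \<notin> range V"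
proof
  assume o: "open_edge a x" and "x \<in> range V"
  then obtain b where b: "x = V b" by blast
  obtain d where "d \<noteq> b" "d \<noteq> a" using three_shift[of b] by (metis)
  then show False using o signed_dist_other[of b d] by (metis b less_irrefl open_edge_def)
qed

lemma interior_not_vertex: "\<forall>a. 0 < signed_dist a x \<Longrightarrow> x \<notin> range V"
  using signed_dist_other three_shift by (metis imageE less_irrefl)

lemma vertexI: assumes "a \<noteq> b" "signed_dist a x = 0" "signed_dist b x = 0" shows "x \<in> range V"
proof -
  let ?c = "other a b"
  have c: "?c \<noteq> a" "?c \<noteq> b" using other_neq[of b a] assms by auto
  have U: "(UNIV :: 3 set) = {a, b, ?c}" using three_UNIV[of a b ?c] c assms by auto
  have "x = V ?c"
  proof (rule eq_by_signed_dist)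
    fix d
    have "(\<Sum>e\<in>UNIV. signed_dist e x / signed_dist e (V e)) = (\<Sum>e\<in>{?c}. signed_dist e x / signed_dist e (V e))"
      by (rule sum.mono_neutral_right) (use U assms in auto)
    then have "signed_dist ?c x = signed_dist ?c (V ?c)"
      using signed_dist_sum[of x] signed_dist_self_pos[of ?c] by (simp add: divide_simps split: if_splits)
    then show "signed_dist d x = signed_dist d (V ?c)"
      using three_cases[of a b ?c d] c assms signed_dist_other by metis
  qed
  then show ?thesis by blast
qed

lemma opnI: assumes "\<forall>a. 0 \<le> signed_dist a x" "x \<notin> range V" "signed_dist a x = 0" shows "open_edge a x"
  unfolding open_edge_def using assms vertexI by (metis less_eq_real_def)

lemma in_edge_iff:
  assumes "b \<noteq> a" "d \<noteq> a" "b \<noteq> d"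
  shows "x \<in> closed_segment (V b) (V d) \<longleftrightarrow> (\<forall>e. 0 \<le> signed_dist e x) \<and> signed_dist a x = 0"
proof
  assume x: "x \<in> closed_segment (V b) (V d)"
  then have x': "x \<in> convex hull {V b, V d}" by (simp only: segment_convex_hull)
  have "{V b, V d} \<subseteq> range V" by simp
  then have "convex hull {V b, V d} \<subseteq> convex hull range V" by (rule hull_mono)
  then have "x \<in> convex hull range V" using x' by (rule subsetD)
  moreover have "closed_segment (V b) (V d) \<subseteq> {x. inward_normal a \<bullet> x = inward_normal a \<bullet> V (a + 1)}"
  proof (rule closed_segment_subset)
    show "V b \<in> {x. inward_normal a \<bullet> x = inward_normal a \<bullet> V (a + 1)}" "V d \<in> {x. inward_normal a \<bullet> x = inward_normal a \<bullet> V (a + 1)}"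
      using signed_dist_other[OF assms(1)] signed_dist_other[OF assms(2)] by (auto simp: signed_dist_def inner_diff_right)
  qed (rule convex_hyperplane)
  ultimately show "(\<forall>e. 0 \<le> signed_dist e x) \<and> signed_dist a x = 0"
    using x unfolding in_region[symmetric] by (auto simp: signed_dist_def inner_diff_right)
next
  assume x: "(\<forall>e. 0 \<le> signed_dist e x) \<and> signed_dist a x = 0"
  obtain l where l: "(\<Sum>a\<in>UNIV. l a) = 1" "x = (\<Sum>a\<in>UNIV. l a *\<^sub>R V a)" "\<And>a. signed_dist a x = l a * signed_dist a (V a)"
    using barycentric[of x] by metis
  have U: "(UNIV :: 3 set) = {a, b, d}" using three_UNIV[of a b d] assms by auto
  have la: "l a = 0" using l(3)[of a] x signed_dist_self_pos[of a] by simp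
  have l0: "0 \<le> l e" for e using x l(3)[of e] signed_dist_self_pos[of e] by (metis zero_le_mult_iff not_le)
  have r: "(\<Sum>e\<in>UNIV. f e) = (\<Sum>e\<in>{b, d}. f e)" if "f a = 0" for f :: "3 \<Rightarrow> 'z::ab_group_add"
    by (rule sum.mono_neutral_right) (use U that in auto)
  have "l b + l d = 1" "x = l b *\<^sub>R V b + l d *\<^sub>R V d"
    using l(1,2) assms la r[of l] r[of "\<lambda>e. l e *\<^sub>R V e"] by auto
  moreover from this have "l b = 1 - l d" by simp
  ultimately show "x \<in> closed_segment (V b) (V d)"
    using l0[of b] l0[of d] unfolding closed_segment_def by (intro CollectI exI[of _ "l d"]) simp
qed

lemma in_edge: "x \<in> closed_segment (V (a + 1)) (V (a + 2)) \<longleftrightarrow> (\<forall>e. 0 \<le> signed_dist e x) \<and> signed_dist a x = 0"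
  using in_edge_iff three_shift by metis

text \<open>Here \<open>v n\<close> is the velocity after the bounce at time \<open>t n\<close>.
  That the times are unbounded is kept apart: it is demanded only where an orbit has to be turned
  into a trajectory on the whole time axis.\<close>

definition orbit :: "(int \<Rightarrow> 3) \<Rightarrow> (int \<Rightarrow> real ^ 2) \<Rightarrow> (int \<Rightarrow> real ^ 2) \<Rightarrow> (int \<Rightarrow> real) \<Rightarrow> bool" where
  "orbit \<iota> p v t \<longleftrightarrow> (\<forall>n. open_edge (\<iota> n) (p n) \<and> norm (v n) = 1 \<and> t n < t (n + 1) \<and>
     p (n + 1) = p n + (t (n + 1) - t n) *\<^sub>R v n \<and> inward_normal (\<iota> (n + 1)) \<bullet> v n < 0 \<and>
     v (n + 1) = reflect (\<iota> (n + 1)) (v n))"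

end

section \<open>Discrete orbits and trajectories in continuous time\<close>

lemma strict_mono_int_step:
  fixes t :: "int \<Rightarrow> 'b::order"
  assumes "\<And>n. t n < t (n + 1)"
  shows "strict_mono t"
proof (rule strict_monoI)
  fix m n :: int assume "m < n"
  then show "t m < t n"
  proof (induction n rule: int_gr_induct)
    case base then show ?case using assms by simp
  next
    case (step n) then show ?case using assms less_trans by blast
  qed
qed

lemma int_partition:
  fixes t :: "int \<Rightarrow> real"
  assumes "\<And>n. t n < t (n + 1)" "t M \<le> s" "s < t N"
  obtains n where "t n \<le> s" "s < t (n + 1)"
proof -
  have sm: "strict_mono t" using assms(1) by (intro strict_mono_int_step)
  then have "M < N" using assms(2,3) by (metis le_less_trans strict_mono_less)
  define S where "S = {n \<in> {M..N}. t n \<le> s}"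
  have fin: "finite S" by (rule finite_subset[of _ "{M..N}"]) (auto simp: S_def)
  have "M \<in> S" using assms(2) \<open>M < N\<close> by (simp add: S_def)
  then have ne: "S \<noteq> {}" by blast
  have m: "Max S \<in> S" using fin ne by (rule Max_in)
  have "s < t (Max S + 1)"
  proof (rule ccontr)
    assume "\<not> s < t (Max S + 1)"
    then have "t (Max S + 1) \<le> s" by simp
    then have "Max S + 1 < N" using assms(3) sm by (meson le_less_trans strict_mono_less)
    then have "Max S + 1 \<in> S" using m \<open>t (Max S + 1) \<le> s\<close> by (auto simp: S_def)
    then show False using fin Max_ge by fastforce
  qed
  then show thesis using that m by (auto simp: S_def)
qed

context billiard_triangle
begin

lemma edge_eq: "vertex P = V \<Longrightarrow> x \<in> edge P a \<longleftrightarrow> (\<forall>e. 0 \<le> signed_dist e x) \<and> signed_dist a x = 0"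
  by (simp add: edge_def in_edge)

lemma edge_direction_eq: "vertex P = V \<Longrightarrow> reflect_along (edge_direction P a) u = reflect a u"
  unfolding edge_direction_def using reflect_along_reflect three_shift by metis

lemma open_edge_edge: "open_edge a x \<Longrightarrow> ((\<forall>e. 0 \<le> signed_dist e x) \<and> signed_dist b x = 0) \<longleftrightarrow> b = a"
  unfolding open_edge_def by (metis less_eq_real_def less_irrefl)

lemma orbitD:
  assumes "orbit \<iota> p v t"
  shows "open_edge (\<iota> n) (p n)" "norm (v n) = 1" "t n < t (n + 1)"
    "p (n + 1) = p n + (t (n + 1) - t n) *\<^sub>R v n" "inward_normal (\<iota> (n + 1)) \<bullet> v n < 0"
    "v (n + 1) = reflect (\<iota> (n + 1)) (v n)"
  using assms unfolding orbit_def by blast+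

text \<open>The distance to the edge hit next decreases to 0, so it is positive before the hit. The
  other two distances are affine along the segment, nonnegative at its start and positive at its
  end.\<close>

lemma orbit_interior:
  assumes "orbit \<iota> p v t" "t n < s" "s < t (n + 1)"
  shows "0 < signed_dist a (p n + (s - t n) *\<^sub>R v n)"
proof -
  let ?h = "t (n + 1) - t n"
  have e: "signed_dist a (p n) = signed_dist a (p (n + 1)) - ?h * (inward_normal a \<bullet> v n)"
    unfolding orbitD(4)[OF assms(1)] signed_dist_add by simp
  show ?thesis
  proof (cases "a = \<iota> (n + 1)")
    case True
    then have "signed_dist a (p (n + 1)) = 0" using orbitD(1)[OF assms(1), of "n + 1"] by (simp add: open_edge_def)
    then have "signed_dist a (p n + (s - t n) *\<^sub>R v n) = (t (n + 1) - s) * - (inward_normal a \<bullet> v n)"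
      using e unfolding signed_dist_add by (simp add: algebra_simps)
    then show ?thesis using assms(3) orbitD(5)[OF assms(1), of n] True by (simp add: mult_pos_neg)
  next
    case False
    then have p1: "0 < signed_dist a (p (n + 1))" using orbitD(1)[OF assms(1), of "n + 1"] by (simp add: open_edge_def)
    have p0: "0 \<le> signed_dist a (p n)" using orbitD(1)[OF assms(1), of n] unfolding open_edge_def by (metis less_eq_real_def)
    have "?h * signed_dist a (p n + (s - t n) *\<^sub>R v n) = (t (n + 1) - s) * signed_dist a (p n) + (s - t n) * signed_dist a (p (n + 1))"
      by (simp only: signed_dist_add e) (simp add: algebra_simps)
    also have "\<dots> > 0" using p0 p1 assms by (intro add_nonneg_pos) auto
    finally show ?thesis using orbitD(3)[OF assms(1), of n] by (simp add: zero_less_mult_iff)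
  qed
qed

text \<open>Straight segments between the bounce points form the trajectory; as the times are
  unbounded in both directions, the intervals between them cover the line.\<close>

lemma orbit_realized:
  fixes P :: "'a triangle"
  assumes P: "vertex P = V" and o: "orbit \<iota> p v t"
    and unb: "\<And>s. \<exists>n. t n \<le> s" "\<And>s. \<exists>n. s < t n" and base: "t (- 1) < 0" "0 \<le> t 0"
  shows "edge_label P \<circ> \<iota> \<in> bounce_spectrum P"
proof -
  have sm: "strict_mono t" using orbitD(3)[OF o] by (intro strict_mono_int_step)
  define idx where "idx = (\<lambda>s. THE n. t n \<le> s \<and> s < t (n + 1))"
  have idx: "idx s = n" if "t n \<le> s" "s < t (n + 1)" for s n
    unfolding idx_def
  proof (rule the_equality)
    fix m assume m: "t m \<le> s \<and> s < t (m + 1)"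
    have "m < n + 1" "n < m + 1" using m that sm by (meson le_less_trans strict_mono_less)+
    then show "m = n" by simp
  qed (use that in simp)
  define g where "g = (\<lambda>s. p (idx s) + (s - t (idx s)) *\<^sub>R v (idx s))"
  have gt: "g (t n) = p n" for n using idx[of n "t n"] orbitD(3)[OF o] by (simp add: g_def)
  \<comment> \<open>The right end is included, because the formula of the old segment still holds at
    the bounce; this gives the incoming velocity there.\<close>
  have g: "g s = p n + (s - t n) *\<^sub>R v n" if "t n \<le> s" "s \<le> t (n + 1)" for s n
    using that gt[of "n+1"] orbitD(4)[OF o, of n] idx[of n s] by (cases "s = t (n + 1)") (auto simp: g_def)
  have cases: "(\<exists>n. s = t n) \<or> (\<exists>n. t n < s \<and> s < t (n + 1))" for s
  proof -
    obtain M N where "t M \<le> s" "s < t N" using unb by blast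
    then obtain n where "t n \<le> s" "s < t (n + 1)" using int_partition[of t M s N] orbitD(3)[OF o] by blast
    then show ?thesis by (metis less_eq_real_def)
  qed
  have int: "\<forall>a. 0 < signed_dist a (g s)" if "t n < s" "s < t (n + 1)" for s n
    using orbit_interior[OF o that] g[of n s] that by simp
  have reg: "region P = convex hull range V" by (simp add: region_def P)
  have "g s \<in> region P \<and> g s \<notin> range (vertex P)" for s
      using cases[of s]
    proof (elim disjE exE conjE)
      fix n assume "s = t n"
      then have "open_edge (\<iota> n) (g s)" using gt orbitD(1)[OF o] by simp
      then show ?thesis using not_vertexI open_edge_edge[of "\<iota> n" "g s" "\<iota> n"] by (simp add: reg in_region P)
    next
      fix n assume "t n < s" "s < t (n + 1)"
      then show ?thesis using int[of n s] interior_not_vertex by (simp add: reg in_region P less_imp_le)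
    qed
  moreover have "\<exists>u w. norm u = 1 \<and> norm w = 1 \<and>
        (\<forall>\<^sub>F h in at_right 0. g (s - h) = g s - h *\<^sub>R u \<and> g (s + h) = g s + h *\<^sub>R w) \<and>
        (g s \<in> interior (region P) \<longrightarrow> w = u) \<and>
        (\<forall>i. g s \<in> edge P i \<longrightarrow> w = reflect_along (edge_direction P i) u)" for s
      using cases[of s]
    proof (elim disjE exE conjE)
      fix n assume s: "s = t n"
      have o': "open_edge (\<iota> n) (g s)" using s gt orbitD(1)[OF o] by simp
      have l1: "t (n - 1) < t n" and l2: "t n < t (n + 1)" using orbitD(3)[OF o, of "n - 1"] orbitD(3)[OF o, of n] by simp_all
      have pn: "p n = p (n - 1) + (t n - t (n - 1)) *\<^sub>R v (n - 1)" using orbitD(4)[OF o, of "n - 1"] by simp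
      have "\<forall>\<^sub>F h in at_right 0. h < min (t n - t (n - 1)) (t (n + 1) - t n)"
        by (rule eventually_at_rightI[of 0 "min (t n - t (n - 1)) (t (n + 1) - t n)"]) (use l1 l2 in auto)
      moreover have "\<forall>\<^sub>F h in at_right 0. 0 < (h::real)" by (rule eventually_at_right_less)
      ultimately have ev: "\<forall>\<^sub>F h in at_right 0. g (s - h) = g s - h *\<^sub>R v (n - 1) \<and> g (s + h) = g s + h *\<^sub>R v n"
      proof eventually_elim
        case (elim h)
        have "g (s - h) = p (n - 1) + (s - h - t (n - 1)) *\<^sub>R v (n - 1)" using elim s by (intro g) auto
        then have "g (s - h) = g s - h *\<^sub>R v (n - 1)" by (simp add: s gt pn algebra_simps)
        moreover have "g (s + h) = p n + (s + h - t n) *\<^sub>R v n" using elim s by (intro g) auto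
        then have "g (s + h) = g s + h *\<^sub>R v n" by (simp add: s gt)
        ultimately show ?case by simp
      qed
      have "g s \<notin> interior (region P)" using o' unfolding reg in_interior open_edge_def by (metis less_irrefl)
      moreover have "v n = reflect_along (edge_direction P i) (v (n - 1))" if "g s \<in> edge P i" for i
        using that open_edge_edge[OF o', of i] orbitD(6)[OF o, of "n - 1"] by (simp add: edge_eq[OF P] edge_direction_eq[OF P])
      ultimately show ?thesis using ev orbitD(2)[OF o] by blast
    next
      fix n assume s: "t n < s" "s < t (n + 1)"
      have "\<forall>\<^sub>F h in at_right 0. h < min (s - t n) (t (n + 1) - s)"
        by (rule eventually_at_rightI[of 0 "min (s - t n) (t (n + 1) - s)"]) (use s in auto)
      moreover have "\<forall>\<^sub>F h in at_right 0. 0 < (h::real)" by (rule eventually_at_right_less)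
      ultimately have ev: "\<forall>\<^sub>F h in at_right 0. g (s - h) = g s - h *\<^sub>R v n \<and> g (s + h) = g s + h *\<^sub>R v n"
      proof eventually_elim
        case (elim h)
        have gs: "g (s - h) = p n + (s - h - t n) *\<^sub>R v n" "g (s + h) = p n + (s + h - t n) *\<^sub>R v n"
          "g s = p n + (s - t n) *\<^sub>R v n" using elim s by (auto intro!: g)
        show ?case unfolding gs by (simp add: algebra_simps)
      qed
      have "0 < signed_dist i (g s)" for i using int[OF s] by blast
      then have "g s \<notin> edge P i" for i by (simp add: edge_eq[OF P] less_imp_neq[symmetric])
      then show ?thesis using ev orbitD(2)[OF o, of n] by (intro exI[of _ "v n"]) simp
    qed
  ultimately have traj: "nonsingular_trajectory P g"
    unfolding nonsingular_trajectory_def by blast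
  have "range t = {s. g s \<in> frontier (region P)}"
  proof (intro equalityI subsetI)
    fix s assume "s \<in> range t"
    then obtain n where "s = t n" by blast
    then show "s \<in> {s. g s \<in> frontier (region P)}"
      using gt[of n] open_edge_frontier[OF orbitD(1)[OF o, of n]] by (simp only: reg mem_Collect_eq)
  next
    fix s assume "s \<in> {s. g s \<in> frontier (region P)}"
    then have "\<not> (\<forall>a. 0 < signed_dist a (g s))" unfolding reg frontier_region in_interior[symmetric] by blast
    then show "s \<in> range t" using cases[of s] int by blast
  qed
  moreover have "\<exists>i. g (t n) \<in> edge P i \<and> (edge_label P \<circ> \<iota>) n = edge_label P i" for n
    using gt orbitD(1)[OF o, of n] open_edge_edge[of "\<iota> n" "p n" "\<iota> n"] by (auto simp: edge_eq[OF P])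
  ultimately have "is_bounce_sequence P g (edge_label P \<circ> \<iota>)"
    unfolding is_bounce_sequence_def using sm base by blast
  then show ?thesis using traj by (auto simp: bounce_spectrum_def)
qed

text \<open>A trajectory is described locally in time; the work lies in showing that between
  consecutive hits it follows one line at one velocity.\<close>

lemma bounce_sequence_orbit:
  fixes P :: "'a triangle"
  assumes P: "vertex P = V" and b: "b \<in> bounce_spectrum P"
  obtains \<iota> p v t where "orbit \<iota> p v t" "b = edge_label P \<circ> \<iota>"
proof -
  obtain g where traj: "nonsingular_trajectory P g" and bs: "is_bounce_sequence P g b"
    using b by (auto simp: bounce_spectrum_def)
  have reg: "region P = convex hull range V" by (simp add: region_def P)
  have gr: "\<forall>a. 0 \<le> signed_dist a (g s)" and gv: "g s \<notin> range V" for s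
    using traj unfolding nonsingular_trajectory_def reg P in_region by blast+
  obtain t where sm: "strict_mono t" and rt: "range t = {s. g s \<in> frontier (region P)}"
    and lab: "\<forall>n. \<exists>i. g (t n) \<in> edge P i \<and> b n = edge_label P i"
    using bs unfolding is_bounce_sequence_def by blast
  obtain \<iota> where \<iota>: "\<And>n. g (t n) \<in> edge P (\<iota> n)" "\<And>n. b n = edge_label P (\<iota> n)"
    using lab by metis
  define loc where "loc = (\<lambda>s u w. norm u = 1 \<and> norm w = 1 \<and>
        (\<forall>\<^sub>F h in at_right 0. g (s - h) = g s - h *\<^sub>R u \<and> g (s + h) = g s + h *\<^sub>R w) \<and>
        (g s \<in> interior (region P) \<longrightarrow> w = u) \<and>
        (\<forall>i. g s \<in> edge P i \<longrightarrow> w = reflect_along (edge_direction P i) u))"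
  have "\<forall>s. \<exists>u w. loc s u w"
    using traj unfolding nonsingular_trajectory_def loc_def by (rule conjunct2)
  then obtain u w where loc: "\<And>s. loc s (u s) (w s)" by metis
  have uw: "\<And>s. norm (u s) = 1" "\<And>s. norm (w s) = 1"
      "\<And>s. \<forall>\<^sub>F h in at_right 0. g (s - h) = g s - h *\<^sub>R u s \<and> g (s + h) = g s + h *\<^sub>R w s"
      "\<And>s. g s \<in> interior (region P) \<Longrightarrow> w s = u s"
      "\<And>s i. g s \<in> edge P i \<Longrightarrow> w s = reflect_along (edge_direction P i) (u s)"
    using loc unfolding loc_def by (simp_all only:)
  have near: "\<exists>e>0. \<forall>h. 0 < h \<and> h < e \<longrightarrow> g (s - h) = g s - h *\<^sub>R u s \<and> g (s + h) = g s + h *\<^sub>R w s" for s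
    using uw(3)[of s] unfolding eventually_at_right_field by blast
  \<comment> \<open>The local descriptions at \<open>s\<close> and at \<open>s + h\<close> overlap
    on a short interval, so their velocities agree.\<close>
  have right: "\<exists>e>0. \<forall>h. 0 < h \<and> h < e \<longrightarrow> g (s + h) = g s + h *\<^sub>R w s \<and> w (s + h) = w s" for s
  proof -
    obtain e where e: "e > 0" "\<And>h. 0 < h \<Longrightarrow> h < e \<Longrightarrow> g (s + h) = g s + h *\<^sub>R w s" using near[of s] by blast
    have "w (s + h) = w s" if h: "0 < h" "h < e" for h
    proof -
      obtain d where d: "d > 0" "\<And>k. 0 < k \<Longrightarrow> k < d \<Longrightarrow> g (s + h + k) = g (s + h) + k *\<^sub>R w (s + h)"
        using near[of "s + h"] by blast
      define k where "k = min d (e - h) / 2"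
      have k: "0 < k" "k < d" "h + k < e" using d(1) h by (auto simp: k_def min_def field_simps)
      have "g s + (h + k) *\<^sub>R w s = g s + h *\<^sub>R w s + k *\<^sub>R w (s + h)"
        using d(2)[OF k(1,2)] e(2)[of "h + k"] e(2)[of h] h k by (simp add: add.assoc)
      then have "k *\<^sub>R w s = k *\<^sub>R w (s + h)" by (simp add: scaleR_add_left)
      then show ?thesis using k(1) by simp
    qed
    then show ?thesis using e by blast
  qed
  have left: "\<exists>e>0. \<forall>h. 0 < h \<and> h < e \<longrightarrow> g (s - h) = g s - h *\<^sub>R u s \<and> w (s - h) = u s" for s
  proof -
    obtain e where e: "e > 0" "\<And>h. 0 < h \<Longrightarrow> h < e \<Longrightarrow> g (s - h) = g s - h *\<^sub>R u s" using near[of s] by blast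
    have "w (s - h) = u s" if h: "0 < h" "h < e" for h
    proof -
      obtain d where d: "d > 0" "\<And>k. 0 < k \<Longrightarrow> k < d \<Longrightarrow> g (s - h + k) = g (s - h) + k *\<^sub>R w (s - h)"
        using near[of "s - h"] by blast
      define k where "k = min d h / 2"
      have k: "0 < k" "k < d" "k < h" using d(1) h by (auto simp: k_def min_def field_simps)
      have "g s - (h - k) *\<^sub>R u s = g s - h *\<^sub>R u s + k *\<^sub>R w (s - h)"
        using d(2)[OF k(1,2)] e(2)[of "h - k"] e(2)[of h] h k by (simp add: algebra_simps)
      then have "k *\<^sub>R u s = k *\<^sub>R w (s - h)" by (simp add: scaleR_diff_left)
      then show ?thesis using k(1) by simp
    qed
    then show ?thesis using e by blast
  qed
  have tn: "t n < t (n + 1)" for n using sm by (simp add: strict_mono_less)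
  have inter: "g s \<in> interior (region P)" if "t n < s" "s < t (n + 1)" for s n
  proof (rule ccontr)
    assume "g s \<notin> interior (region P)"
    then have "s \<in> range t" unfolding rt using gr[of s] unfolding reg frontier_region in_region[symmetric] by blast
    then obtain m where "s = t m" by blast
    then have "n < m" "m < n + 1" using that sm by (simp_all add: strict_mono_less)
    then show False by simp
  qed
  \<comment> \<open>Velocity and position extrapolated to time 0 determine the parametrized line.
    This pair is locally constant between hits, hence constant on the open interval, which is
    connected; \<open>right\<close> extends it to the left end.\<close>
  have line: "(w s, g s - s *\<^sub>R w s) = (w (t n), g (t n) - t n *\<^sub>R w (t n))" if s: "t n < s" "s < t (n + 1)" for s n
  proof -
    let ?F = "\<lambda>s. (w s, g s - s *\<^sub>R w s)"
    let ?A = "{t n<..<t (n + 1)}"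
    obtain e where e: "e > 0" "\<And>h. 0 < h \<Longrightarrow> h < e \<Longrightarrow> g (t n + h) = g (t n) + h *\<^sub>R w (t n) \<and> w (t n + h) = w (t n)"
      using right[of "t n"] by blast
    define h where "h = min e (t (n + 1) - t n) / 2"
    have h: "0 < h" "h < e" "h < t (n + 1) - t n" using e(1) tn[of n] by (auto simp: h_def min_def field_simps)
    have F0: "?F (t n + h) = ?F (t n)" using e(2)[OF h(1,2)] by (simp add: algebra_simps)
    have "?F s = ?F (t n + h)"
    proof (rule connected_local_const[of ?A])
      show "connected ?A" by simp
      show "s \<in> ?A" "t n + h \<in> ?A" using s h by auto
      show "\<forall>a\<in>?A. \<forall>\<^sub>F b in at a within ?A. ?F a = ?F b"
      proof
        fix a assume a: "a \<in> ?A"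
        then have wu: "w a = u a" using inter uw(4) by auto
        obtain e1 where e1: "e1 > 0" "\<And>h. 0 < h \<Longrightarrow> h < e1 \<Longrightarrow> g (a + h) = g a + h *\<^sub>R w a \<and> w (a + h) = w a"
          using right[of a] by blast
        obtain e2 where e2: "e2 > 0" "\<And>h. 0 < h \<Longrightarrow> h < e2 \<Longrightarrow> g (a - h) = g a - h *\<^sub>R w a \<and> w (a - h) = w a"
          using left[of a] wu by auto
        have F: "?F a = ?F b" if "b \<noteq> a" "dist b a < min e1 e2" for b
        proof (cases "a < b")
          case True
          then show ?thesis using e1(2)[of "b - a"] that by (simp add: dist_real_def algebra_simps)
        next
          case False
          then show ?thesis using e2(2)[of "a - b"] that by (simp add: dist_real_def algebra_simps)
        qed
        show "\<forall>\<^sub>F b in at a within ?A. ?F a = ?F b"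
          unfolding eventually_at using e1(1) e2(1) F by (intro exI[of _ "min e1 e2"]) auto
      qed
    qed
    then show ?thesis using F0 by (rule trans)
  qed
  define p where "p = (\<lambda>n. g (t n))"
  define v where "v = (\<lambda>n. w (t n))"
  have seg: "u (t (n + 1)) = v n \<and> p (n + 1) = p n + (t (n + 1) - t n) *\<^sub>R v n" for n
  proof -
    obtain e where e: "e > 0" "\<And>h. 0 < h \<Longrightarrow> h < e \<Longrightarrow> g (t (n + 1) - h) = g (t (n + 1)) - h *\<^sub>R u (t (n + 1)) \<and> w (t (n + 1) - h) = u (t (n + 1))"
      using left[of "t (n + 1)"] by blast
    define h where "h = min e (t (n + 1) - t n) / 2"
    have h: "0 < h" "h < e" "h < t (n + 1) - t n" using e(1) tn[of n] by (auto simp: h_def min_def field_simps)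
    have "(w (t (n + 1) - h), g (t (n + 1) - h) - (t (n + 1) - h) *\<^sub>R w (t (n + 1) - h)) = (v n, p n - t n *\<^sub>R v n)"
      unfolding v_def p_def by (rule line) (use h in auto)
    then have q: "w (t (n + 1) - h) = v n" "g (t (n + 1) - h) = p n - t n *\<^sub>R v n + (t (n + 1) - h) *\<^sub>R v n"
      by (auto simp: algebra_simps)
    have "u (t (n + 1)) = v n" using e(2)[OF h(1,2)] q(1) by simp
    moreover have "g (t (n + 1)) = g (t (n + 1) - h) + h *\<^sub>R u (t (n + 1))" using e(2)[OF h(1,2)] by simp
    ultimately show ?thesis using q(2) by (simp add: p_def algebra_simps)
  qed
  have o: "open_edge (\<iota> n) (p n)" for n
    using opnI gr gv \<iota>(1)[of n] edge_eq[OF P] by (simp add: p_def)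
  have "inward_normal (\<iota> (n + 1)) \<bullet> v n < 0" for n
  proof -
    let ?a = "\<iota> (n + 1)"
    define s where "s = (t n + t (n + 1)) / 2"
    have s: "t n < s" "s < t (n + 1)" using tn[of n] by (auto simp: s_def field_simps)
    have "0 < signed_dist ?a (g s)" using inter[OF s] by (simp add: reg in_interior)
    moreover have gs: "g s = p n + (s - t n) *\<^sub>R v n"
    proof -
      have "w s = w (t n)" "g s - s *\<^sub>R w s = g (t n) - t n *\<^sub>R w (t n)"
        using line[OF s] unfolding prod.inject by blast+
      then have "g s - s *\<^sub>R w (t n) = g (t n) - t n *\<^sub>R w (t n)" by (simp only:)
      then show ?thesis by (simp add: p_def v_def algebra_simps)
    qed
    have "p (n + 1) = g s + (t (n + 1) - s) *\<^sub>R v n"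
      unfolding gs conjunct2[OF seg] by (simp add: algebra_simps)
    then have "signed_dist ?a (p (n + 1)) = signed_dist ?a (g s) + (t (n + 1) - s) * (inward_normal ?a \<bullet> v n)" by (simp add: signed_dist_add)
    moreover have "signed_dist ?a (p (n + 1)) = 0" using o[of "n + 1"] by (simp add: open_edge_def)
    ultimately have "(t (n + 1) - s) * (inward_normal ?a \<bullet> v n) < 0" by simp
    then show ?thesis using s by (simp add: mult_less_0_iff)
  qed
  moreover have "v (n + 1) = reflect (\<iota> (n + 1)) (v n)" for n
    using uw(5)[OF \<iota>(1)[of "n + 1"]] seg[of n] by (simp add: edge_direction_eq[OF P] v_def)
  ultimately have "orbit \<iota> p v t"
    unfolding orbit_def using o uw(2) tn seg by (simp add: v_def)
  moreover have "b = edge_label P \<circ> \<iota>" using \<iota>(2) by (simp add: fun_eq_iff)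
  ultimately show thesis by (rule that)
qed


section \<open>Trajectories near a corner\<close>

definition affine_reflect :: "3 \<Rightarrow> real ^ 2 \<Rightarrow> real ^ 2" where
  "affine_reflect a x = x - (2 * signed_dist a x) *\<^sub>R inward_normal a"

text \<open>A trajectory hits a vertex iff the straight line that unfolds it passes through one of these countably
many points.\<close>

definition unfolded_vertices :: "(real ^ 2) set" where
  "unfolded_vertices = {foldr affine_reflect w (V b) | w b. True}"

text \<open>Phrased by distances so as to cover starts in the interior, on an open edge and at a
  vertex alike; at a vertex the velocity must point inwards with respect to both sides.\<close>

definition admissible :: "real ^ 2 \<Rightarrow> real ^ 2 \<Rightarrow> bool" where
  "admissible p v \<longleftrightarrow> (\<forall>a. 0 < signed_dist a p \<or> (signed_dist a p = 0 \<and> 0 < inward_normal a \<bullet> v))"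

text \<open>The bound on \<open>L\<close> is strict because the start may itself be a
  vertex.\<close>

definition generic :: "real ^ 2 \<Rightarrow> real ^ 2 \<Rightarrow> bool" where
  "generic p v \<longleftrightarrow> (\<forall>L>0. p + L *\<^sub>R v \<notin> unfolded_vertices)"

definition good :: "real ^ 2 \<Rightarrow> real ^ 2 \<Rightarrow> bool" where
  "good p v \<longleftrightarrow> norm v = 1 \<and> admissible p v \<and> generic p v"

text \<open>A finite word, in contrast to an infinite one, is an open condition on the starting
  point; see \<open>run_stable\<close>.\<close>

fun run :: "3 list \<Rightarrow> real ^ 2 \<Rightarrow> real ^ 2 \<Rightarrow> bool" where
  "run [] p v \<longleftrightarrow> True"
| "run (a # w) p v \<longleftrightarrow> (\<exists>h>0. inward_normal a \<bullet> v < 0 \<and> open_edge a (p + h *\<^sub>R v) \<and> run w (p + h *\<^sub>R v) (reflect a v))"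

text \<open>The index is shifted against \<open>orbit\<close>: \<open>\<iota> n\<close> is the edge
  hit at the end of step \<open>n\<close>, at \<open>p (Suc n)\<close>. Thus \<open>p 0\<close> lies
  on no prescribed edge and may be a corner.\<close>

definition ipath :: "(nat \<Rightarrow> 3) \<Rightarrow> (nat \<Rightarrow> real ^ 2) \<Rightarrow> (nat \<Rightarrow> real ^ 2) \<Rightarrow> (nat \<Rightarrow> real) \<Rightarrow> bool" where
  "ipath \<iota> p v h \<longleftrightarrow> (\<forall>n. 0 < h n \<and> inward_normal (\<iota> n) \<bullet> v n < 0 \<and> p (Suc n) = p n + h n *\<^sub>R v n \<and>
     open_edge (\<iota> n) (p (Suc n)) \<and> v (Suc n) = reflect (\<iota> n) (v n))"

lemma countable_unfolded: "countable unfolded_vertices"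
proof -
  have "unfolded_vertices = (\<lambda>(w, b). foldr affine_reflect w (V b)) ` (UNIV :: (3 list \<times> 3) set)"
    by (auto simp: unfolded_vertices_def)
  moreover have "countable (UNIV :: (3 list \<times> 3) set)" by (intro countableI_type)
  ultimately show ?thesis by simp
qed

lemma V_unfolded: "V b \<in> unfolded_vertices"
  unfolding unfolded_vertices_def by (intro CollectI exI[of _ "[]"] exI[of _ b]) simp

lemma affine_reflect_unfolded: "x \<in> unfolded_vertices \<Longrightarrow> affine_reflect a x \<in> unfolded_vertices"
  unfolding unfolded_vertices_def
proof (elim CollectE exE conjE)
  fix w b assume "x = foldr affine_reflect w (V b)"
  then show "affine_reflect a x \<in> {foldr affine_reflect w (V b) | w b. True}" by (intro CollectI exI[of _ "a # w"] exI[of _ b]) simp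
qed

lemma affine_reflect_line:
  assumes "signed_dist a p = 0"
  shows "affine_reflect a (p + L *\<^sub>R reflect a v) = p + L *\<^sub>R v"
proof -
  have "signed_dist a (p + L *\<^sub>R reflect a v) = - L * (inward_normal a \<bullet> v)" using assms by (simp add: signed_dist_add inward_normal_reflect)
  then show ?thesis by (simp add: affine_reflect_def reflect_def inner_commute algebra_simps)
qed

lemma admissible_open_edge: assumes "open_edge a p" "0 < inward_normal a \<bullet> v" shows "admissible p v"
  using assms unfolding open_edge_def admissible_def by metis

text \<open>The reflection in edge \<open>a\<close> carries the new ray onto the continuation of the
  old one and preserves the set of unfolded vertices, so genericity is inherited.\<close>

lemma good_step:
  assumes "good p v" "0 < h" "inward_normal a \<bullet> v < 0" "open_edge a (p + h *\<^sub>R v)"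
  shows "good (p + h *\<^sub>R v) (reflect a v)"
proof -
  have "generic (p + h *\<^sub>R v) (reflect a v)"
    unfolding generic_def
  proof (intro allI impI notI)
    fix L :: real assume L: "0 < L" "p + h *\<^sub>R v + L *\<^sub>R reflect a v \<in> unfolded_vertices"
    then have "affine_reflect a (p + h *\<^sub>R v + L *\<^sub>R reflect a v) \<in> unfolded_vertices" by (intro affine_reflect_unfolded)
    then have "p + h *\<^sub>R v + L *\<^sub>R v \<in> unfolded_vertices"
      using affine_reflect_line[of a "p + h *\<^sub>R v" L v] assms(4) by (simp add: open_edge_def)
    then have "p + (h + L) *\<^sub>R v \<in> unfolded_vertices" by (simp add: algebra_simps)
    then show False using assms(1,2) L(1) unfolding good_def generic_def by (meson add_pos_pos)
  qed
  moreover have "admissible (p + h *\<^sub>R v) (reflect a v)" using admissible_open_edge[OF assms(4)] assms(3) by (simp add: inward_normal_reflect)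
  ultimately show ?thesis using assms(1) by (simp add: good_def)
qed

text \<open>By \<open>signed_dist_sum\<close> the three normal components of \<open>v\<close>,
  suitably weighted, add up to 0. If none is negative they all vanish, and a point is determined by
  its three distances.\<close>

lemma inward_normal_neg_exists: assumes "v \<noteq> 0" shows "\<exists>a. inward_normal a \<bullet> v < 0"
proof (rule ccontr)
  assume "\<not> (\<exists>a. inward_normal a \<bullet> v < 0)"
  then have nn: "0 \<le> inward_normal a \<bullet> v" for a by (simp add: not_less)
  have "(\<Sum>a\<in>UNIV. signed_dist a (0 + v) / signed_dist a (V a)) - (\<Sum>a\<in>UNIV. signed_dist a 0 / signed_dist a (V a)) = 0" unfolding signed_dist_sum by simp
  then have "(\<Sum>a\<in>UNIV. (inward_normal a \<bullet> v) / signed_dist a (V a)) = 0"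
    unfolding signed_dist_add by (simp add: add_divide_distrib sum.distrib)
  then have "(inward_normal a \<bullet> v) / signed_dist a (V a) = 0" for a
    by (subst (asm) sum_nonneg_eq_0_iff) (use nn signed_dist_self_pos in \<open>auto intro: divide_nonneg_pos\<close>)
  then have "inward_normal a \<bullet> v = 0" for a using signed_dist_self_pos[of a] by (metis divide_eq_0_iff less_irrefl)
  then have "signed_dist a (0 + v) = signed_dist a 0" for a unfolding signed_dist_add by simp
  then have "0 + v = 0" by (rule eq_by_signed_dist)
  then show False using assms by simp
qed

text \<open>Among the edge lines that are approached, the one reached first is met on the boundary
  of the triangle; genericity keeps the meeting point off the vertices.\<close>

lemma good_exits:
  assumes "good p v"
  shows "\<exists>a h. 0 < h \<and> inward_normal a \<bullet> v < 0 \<and> open_edge a (p + h *\<^sub>R v)"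
proof -
  define S where "S = {a. inward_normal a \<bullet> v < 0}"
  define \<tau> where "\<tau> = (\<lambda>a. signed_dist a p / - (inward_normal a \<bullet> v))"
  have "v \<noteq> 0" using assms by (auto simp: good_def)
  then have "finite S" "S \<noteq> {}" using inward_normal_neg_exists by (auto simp: S_def)
  then have "arg_min_on \<tau> S \<in> S" "\<And>b. b \<in> S \<Longrightarrow> \<tau> (arg_min_on \<tau> S) \<le> \<tau> b"
    by (simp_all add: arg_min_if_finite arg_min_least)
  then obtain a where a: "a \<in> S" "\<And>b. b \<in> S \<Longrightarrow> \<tau> a \<le> \<tau> b" by blast
  have na: "inward_normal a \<bullet> v < 0" using a(1) by (simp add: S_def)
  have sp: "0 < signed_dist b p \<or> (signed_dist b p = 0 \<and> 0 < inward_normal b \<bullet> v)" for b using assms unfolding good_def admissible_def by blast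
  have "0 < signed_dist a p" using sp[of a] na by auto
  then have h: "0 < \<tau> a" using na by (simp add: \<tau>_def divide_pos_neg)
  have z: "signed_dist a (p + \<tau> a *\<^sub>R v) = 0" unfolding signed_dist_add using na by (simp add: \<tau>_def)
  have nn: "0 \<le> signed_dist b (p + \<tau> a *\<^sub>R v)" for b
  proof (cases "inward_normal b \<bullet> v < 0")
    case True
    then have "\<tau> a \<le> signed_dist b p / - (inward_normal b \<bullet> v)" using a(2)[of b] by (simp add: S_def \<tau>_def)
    then have "\<tau> a * - (inward_normal b \<bullet> v) \<le> signed_dist b p" using True by (subst (asm) pos_le_divide_eq) auto
    then show ?thesis by (simp add: signed_dist_add)
  next
    case False
    then show ?thesis using sp[of b] h by (auto simp: signed_dist_add)
  qed
  have "p + \<tau> a *\<^sub>R v \<notin> unfolded_vertices" using assms h unfolding good_def generic_def by blast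
  then have "p + \<tau> a *\<^sub>R v \<notin> range V" using V_unfolded by auto
  then have "open_edge a (p + \<tau> a *\<^sub>R v)" using nn z by (intro opnI) auto
  then show ?thesis using h na by blast
qed

lemma good_ipath:
  assumes "good p0 v0"
  obtains \<iota> p v h where "ipath \<iota> p v h" "p 0 = p0" "v 0 = v0"
proof -
  have "\<forall>p v. \<exists>a h. good p v \<longrightarrow> 0 < h \<and> inward_normal a \<bullet> v < 0 \<and> open_edge a (p + h *\<^sub>R v)" using good_exits by blast
  then obtain A H where AH: "\<And>p v. good p v \<Longrightarrow> 0 < H p v \<and> inward_normal (A p v) \<bullet> v < 0 \<and> open_edge (A p v) (p + H p v *\<^sub>R v)"
    by metis
  define st where "st = rec_nat (p0, v0) (\<lambda>_ (p, v). (p + H p v *\<^sub>R v, reflect (A p v) v))"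
  define p where "p = (\<lambda>n. fst (st n))"
  define v where "v = (\<lambda>n. snd (st n))"
  have p0: "p 0 = p0" "v 0 = v0" by (simp_all add: p_def v_def st_def)
  have st: "p (Suc n) = p n + H (p n) (v n) *\<^sub>R v n" "v (Suc n) = reflect (A (p n) (v n)) (v n)" for n
    by (simp_all add: p_def v_def st_def case_prod_beta)
  have g: "good (p n) (v n)" for n
  proof (induction n)
    case 0 then show ?case using assms p0 by simp
  next
    case (Suc n) then show ?case unfolding st using AH[OF Suc.IH] good_step by blast
  qed
  have "ipath (\<lambda>n. A (p n) (v n)) p v (\<lambda>n. H (p n) (v n))"
    unfolding ipath_def st using AH[OF g] by blast
  then show thesis using that p0 by blast
qed

lemma ipath_shift: "ipath \<iota> p v h \<Longrightarrow> ipath (\<lambda>n. \<iota> (n + m)) (\<lambda>n. p (n + m)) (\<lambda>n. v (n + m)) (\<lambda>n. h (n + m))"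
  unfolding ipath_def by (metis add_Suc)

lemma ipath_run: "ipath \<iota> p v h \<Longrightarrow> run (map \<iota> [0..<N]) (p 0) (v 0)"
proof (induction N arbitrary: \<iota> p v h)
  case (Suc N)
  have e: "map \<iota> [0..<Suc N] = \<iota> 0 # map (\<lambda>n. \<iota> (n + 1)) [0..<N]"
    by (simp add: upt_conv_Cons map_Suc_upt[symmetric] del: upt_Suc)
  have r: "run (map (\<lambda>n. \<iota> (n + 1)) [0..<N]) (p (0 + 1)) (v (0 + 1))"
    using Suc.IH[OF ipath_shift[OF Suc.prems, of 1]] .
  have "0 < h 0 \<and> inward_normal (\<iota> 0) \<bullet> v 0 < 0 \<and> p (Suc 0) = p 0 + h 0 *\<^sub>R v 0 \<and> open_edge (\<iota> 0) (p (Suc 0)) \<and> v (Suc 0) = reflect (\<iota> 0) (v 0)"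
    using Suc.prems unfolding ipath_def by blast
  then show ?case unfolding e using r by auto
qed simp

text \<open>The word prescribes the first bounces; genericity survives them and supplies the
  others.\<close>

lemma run_ipath:
  assumes "good p0 v0" "run w p0 v0"
  shows "\<exists>\<iota> p v h. ipath \<iota> p v h \<and> p 0 = p0 \<and> v 0 = v0 \<and> (\<forall>n<length w. \<iota> n = w ! n)"
  using assms
proof (induction w arbitrary: p0 v0)
  case Nil
  then show ?case using good_ipath[of p0 v0] by (metis length_0_conv less_zeroE)
next
  case (Cons a w)
  then obtain k where k: "0 < k" "inward_normal a \<bullet> v0 < 0" "open_edge a (p0 + k *\<^sub>R v0)" "run w (p0 + k *\<^sub>R v0) (reflect a v0)"
    by auto
  obtain \<iota> p v h where ih: "ipath \<iota> p v h" "p 0 = p0 + k *\<^sub>R v0" "v 0 = reflect a v0" "\<forall>n<length w. \<iota> n = w ! n"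
    using Cons.IH[OF good_step[OF Cons.prems(1) k(1-3)] k(4)] by blast
  have "ipath (case_nat a \<iota>) (case_nat p0 p) (case_nat v0 v) (case_nat k h)"
    unfolding ipath_def
  proof
    fix n
    show "0 < case_nat k h n \<and> inward_normal (case_nat a \<iota> n) \<bullet> case_nat v0 v n < 0 \<and>
      case_nat p0 p (Suc n) = case_nat p0 p n + case_nat k h n *\<^sub>R case_nat v0 v n \<and>
      open_edge (case_nat a \<iota> n) (case_nat p0 p (Suc n)) \<and> case_nat v0 v (Suc n) = reflect (case_nat a \<iota> n) (case_nat v0 v n)"
    proof (cases n)
      case 0 then show ?thesis using k ih(2,3) by simp
    next
      case (Suc m) then show ?thesis unfolding Suc nat.case by (intro ih(1)[unfolded ipath_def, rule_format])
    qed
  qed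
  moreover have "\<forall>n<length (a # w). case_nat a \<iota> n = (a # w) ! n"
    using ih(4) by (auto simp: nth_Cons split: nat.splits)
  ultimately show ?case by (metis nat.case(1))
qed

text \<open>Every hit is transversal and lies in an open edge, so the hitting point depends
  continuously on the start. A convergent family \<open>f\<close> is used because the hitting points
  form such a family again, as the induction requires.\<close>

lemma run_stable:
  assumes "run w p v" "(f \<longlongrightarrow> p) F"
  shows "\<forall>\<^sub>F x in F. run w (f x) v"
  using assms
proof (induction w arbitrary: p v f)
  case (Cons a w)
  then obtain h where h: "0 < h" "inward_normal a \<bullet> v < 0" "open_edge a (p + h *\<^sub>R v)" "run w (p + h *\<^sub>R v) (reflect a v)"
    by auto
  \<comment> \<open>The time at which the line of edge \<open>a\<close> is reached from
    \<open>f x\<close>.\<close>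
  define k where "k = (\<lambda>x. - signed_dist a (f x) / (inward_normal a \<bullet> v))"
  have lim_signed_dist: "((\<lambda>x. signed_dist b (g x)) \<longlongrightarrow> signed_dist b q) F" if "(g \<longlongrightarrow> q) F" for b g q
    unfolding signed_dist_def using that by (intro tendsto_intros)
  have "signed_dist a p = - h * (inward_normal a \<bullet> v)" using h(3) by (simp add: open_edge_def signed_dist_add)
  then have "h = - signed_dist a p / (inward_normal a \<bullet> v)" using h(2) by simp
  then have k: "(k \<longlongrightarrow> h) F"
    unfolding k_def using lim_signed_dist[OF Cons.prems(2)] h(2) by (auto intro!: tendsto_intros)
  have lim: "((\<lambda>x. f x + k x *\<^sub>R v) \<longlongrightarrow> p + h *\<^sub>R v) F"
    using k Cons.prems(2) by (intro tendsto_intros)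
  have "\<forall>\<^sub>F x in F. 0 < k x" using k h(1) by (simp add: order_tendstoD(1))
  moreover have "\<forall>\<^sub>F x in F. run w (f x + k x *\<^sub>R v) (reflect a v)" using Cons.IH[OF h(4) lim] .
  moreover have "\<forall>\<^sub>F x in F. \<forall>b\<in>UNIV - {a}. 0 < signed_dist b (f x + k x *\<^sub>R v)"
  proof (rule eventually_ball_finite)
    show "\<forall>b\<in>UNIV - {a}. \<forall>\<^sub>F x in F. 0 < signed_dist b (f x + k x *\<^sub>R v)"
      using order_tendstoD(1)[OF lim_signed_dist[OF lim]] h(3) by (simp add: open_edge_def)
  qed simp
  ultimately show ?case
  proof eventually_elim
    case (elim x)
    have "signed_dist a (f x + k x *\<^sub>R v) = 0" unfolding signed_dist_add using h(2) by (simp add: k_def)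
    then have "open_edge a (f x + k x *\<^sub>R v)" using elim(3) by (simp add: open_edge_def)
    then show ?case using elim h(2) by auto
  qed
qed simp

lemma open_edge_ray:
  assumes "a \<noteq> c" "0 < r" "r < norm (V (other c a) - V c)"
  shows "open_edge a (V c + r *\<^sub>R ray c a)"
proof -
  let ?l = "norm (V (other c a) - V c)" and ?b = "other c a"
  have b: "?b \<noteq> a" "?b \<noteq> c" using other_neq[OF assms(1)] by auto
  have "signed_dist a (V c + r *\<^sub>R ray c a) = 0" using assms(1) ray_orth[OF assms(1)] by (simp add: signed_dist_add inner_commute)
  moreover have "0 < signed_dist ?b (V c + r *\<^sub>R ray c a)"
    using b assms inward_normal_other_ray_pos[OF assms(1)] by (simp add: signed_dist_add)
  moreover have "0 < signed_dist c (V c + r *\<^sub>R ray c a)"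
  proof -
    have "signed_dist c (V c + ?l *\<^sub>R ray c a) = 0" using ray_scale[OF assms(1)] b by (metis signed_dist_other)
    then have e: "?l * (inward_normal c \<bullet> ray c a) = - signed_dist c (V c)" by (simp add: signed_dist_add)
    have "?l * signed_dist c (V c + r *\<^sub>R ray c a) = ?l * signed_dist c (V c) + r * (?l * (inward_normal c \<bullet> ray c a))"
      by (simp add: signed_dist_add algebra_simps)
    also have "\<dots> = (?l - r) * signed_dist c (V c)" unfolding e by (simp add: algebra_simps)
    also have "\<dots> > 0" using assms signed_dist_self_pos by simp
    finally show ?thesis by (simp add: zero_less_mult_iff)
  qed
  ultimately show ?thesis unfolding open_edge_def using three_cases[of a c ?b] assms(1) b by metis
qed

text \<open>Each bounce in the fan around \<open>c\<close> lowers the outgoing angle by \<open>ang c\<close>; once it is below \<open>ang c\<close>, the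
trajectory follows the ray from the corner itself, whose word is stable under small displacements.\<close>

lemma fan_run:
  assumes "a \<noteq> c" "0 < d" "real k * ang c < \<tau>" "\<tau> < (real k + 1) * ang c" "\<tau> < pi"
    and "run w (V c) (dir c ((other c ^^ k) a) (\<tau> - real k * ang c))"
  shows "\<forall>\<^sub>F \<delta> in at_right 0. run (map (\<lambda>j. (other c ^^ Suc j) a) [0..<k] @ w) (V c + (\<delta> * d) *\<^sub>R ray c a) (dir c a \<tau>)"
  using assms
proof (induction k arbitrary: a d \<tau>)
  case 0
  have "((\<lambda>\<delta>. V c + (\<delta> * d) *\<^sub>R ray c a) \<longlongrightarrow> V c + (0 * d) *\<^sub>R ray c a) (at_right 0)"
    by (intro tendsto_intros)
  then show ?case using run_stable 0 by simp
next
  case (Suc k)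
  let ?b = "other c a" and ?t = "ang c"
  have b: "?b \<noteq> c" using other_neq Suc.prems(1) by simp
  have t: "0 < ?t" "?t < pi" using ang_bounds by auto
  have tt: "?t < \<tau>" using Suc.prems(3) t by (simp add: algebra_simps) (smt (verit) mult_nonneg_nonneg of_nat_0_le_iff)
  have s1: "0 < sin (\<tau> - ?t)" using tt Suc.prems(5) t by (intro sin_gt_zero) auto
  have s2: "0 < sin \<tau>" using tt Suc.prems(5) t by (intro sin_gt_zero) auto
  have s3: "0 < sin ?t" using t by (intro sin_gt_zero)
  \<comment> \<open>Law of sines in the triangle formed by the corner, the start and the next hit:
    its angles are \<open>ang c\<close>, \<open>pi - \<tau>\<close> and
    \<open>\<tau> - ang c\<close>. The distance from the corner is multiplied by a factor
    independent of \<open>\<delta>\<close>, hence the free parameter \<open>d\<close> in the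
    induction.\<close>
  define d' where "d' = d * sin \<tau> / sin (\<tau> - ?t)"
  have d': "0 < d'" using Suc.prems(2) s1 s2 by (simp add: d'_def)
  have "run w (V c) (dir c ((other c ^^ k) ?b) (\<tau> - ?t - real k * ?t))"
    using Suc.prems(6) by (simp add: funpow_swap1 algebra_simps)
  then have ih: "\<forall>\<^sub>F \<delta> in at_right 0. run (map (\<lambda>j. (other c ^^ Suc j) ?b) [0..<k] @ w) (V c + (\<delta> * d') *\<^sub>R ray c ?b) (dir c ?b (\<tau> - ?t))"
    using Suc.prems(3,4,5) b d' t by (intro Suc.IH) (auto simp: algebra_simps)
  define l where "l = norm (V (other c ?b) - V c)"
  have "0 < l" using V_neq[of a c] Suc.prems(1) by (simp add: l_def)
  \<comment> \<open>This keeps the next hit short of the far end of its edge.\<close>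
  then have "\<forall>\<^sub>F \<delta> in at_right 0. \<delta> < l / d'"
    by (intro eventually_at_rightI[of 0 "l / d'"]) (use d' in auto)
  moreover have "\<forall>\<^sub>F \<delta> in at_right 0. 0 < (\<delta>::real)" by (rule eventually_at_right_less)
  ultimately show ?case using ih
  proof eventually_elim
    case (elim \<delta>)
    define h where "h = \<delta> * d * sin ?t / sin (\<tau> - ?t)"
    have h: "0 < h" using elim(2) Suc.prems(2) s1 s3 by (simp add: h_def)
    have pt: "V c + (\<delta> * d) *\<^sub>R ray c a + h *\<^sub>R dir c a \<tau> = V c + (\<delta> * d') *\<^sub>R ray c ?b"
    proof -
      have c1: "\<delta> * d + h * cos \<tau> = \<delta> * d' * cos ?t"
        using s1 by (simp add: h_def d'_def field_simps sin_diff)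
      have c2: "h * sin \<tau> = \<delta> * d' * sin ?t" by (simp add: h_def d'_def)
      have "(\<delta> * d) *\<^sub>R ray c a + h *\<^sub>R dir c a \<tau> = (\<delta> * d + h * cos \<tau>) *\<^sub>R ray c a + (h * sin \<tau>) *\<^sub>R inward_normal a"
        by (simp add: dir_def algebra_simps)
      also have "\<dots> = (\<delta> * d') *\<^sub>R ray c ?b" unfolding c1 c2 ray_other(1)[OF Suc.prems(1)] by (simp add: algebra_simps)
      finally show ?thesis by (simp add: add.assoc)
    qed
    have "open_edge ?b (V c + (\<delta> * d') *\<^sub>R ray c ?b)"
      using b d' elim(1,2) by (intro open_edge_ray) (simp_all add: l_def field_simps)
    moreover have "inward_normal ?b \<bullet> dir c a \<tau> < 0"
      using s1 inward_normal_other_dir[OF Suc.prems(1), of \<tau>] sin_minus[of "\<tau> - ?t"] by simp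
    moreover have "reflect ?b (dir c a \<tau>) = dir c ?b (\<tau> - ?t)" using reflect_other_dir Suc.prems(1) by simp
    moreover have fan: "map (\<lambda>j. (other c ^^ Suc j) a) [0..<Suc k] = ?b # map (\<lambda>j. (other c ^^ Suc j) ?b) [0..<k]"
      by (simp add: upt_conv_Cons map_Suc_upt[symmetric] funpow_swap1 del: upt_Suc)
    ultimately have "run (?b # (map (\<lambda>j. (other c ^^ Suc j) ?b) [0..<k] @ w)) (V c + (\<delta> * d) *\<^sub>R ray c a) (dir c a \<tau>)"
      unfolding run.simps using elim(3) h by (intro exI[of _ h]) (simp only: pt simp_thms)
    then show ?case by (simp only: fan append_Cons)
  qed
qed

text \<open>For a fixed direction, each unfolded vertex is met from at most one point of the line of
  edge \<open>a\<close>; \<open>?F\<close> is the projection onto this line along the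
  direction.\<close>

lemma countable_nongeneric_point:
  assumes "a \<noteq> c" "sin \<tau> \<noteq> 0"
  shows "countable {\<delta>. \<not> generic (V c + \<delta> *\<^sub>R ray c a) (dir c a \<tau>)}"
proof (rule countable_subset)
  let ?F = "\<lambda>q. (q - V c) \<bullet> ray c a - cos \<tau> / sin \<tau> * ((q - V c) \<bullet> inward_normal a)"
  show "countable (?F ` unfolded_vertices)" using countable_unfolded by simp
  show "{\<delta>. \<not> generic (V c + \<delta> *\<^sub>R ray c a) (dir c a \<tau>)} \<subseteq> ?F ` unfolded_vertices"
  proof
    fix \<delta> assume "\<delta> \<in> {\<delta>. \<not> generic (V c + \<delta> *\<^sub>R ray c a) (dir c a \<tau>)}"
    then obtain L where L: "V c + \<delta> *\<^sub>R ray c a + L *\<^sub>R dir c a \<tau> \<in> unfolded_vertices" (is "?q \<in> _")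
      by (auto simp: generic_def)
    have r: "ray c a \<bullet> ray c a = 1" "inward_normal a \<bullet> ray c a = 0" "ray c a \<bullet> inward_normal a = 0"
      using assms(1) ray_orth[OF assms(1)] by (auto simp: dot_square_norm inner_commute)
    have e: "?q - V c = (\<delta> + L * cos \<tau>) *\<^sub>R ray c a + (L * sin \<tau>) *\<^sub>R inward_normal a" by (simp add: dir_def algebra_simps)
    have "?F ?q = \<delta>" unfolding e using r assms(2) by (simp add: inner_left_distrib)
    moreover have "?F ?q \<in> ?F ` unfolded_vertices" using L by (rule imageI)
    ultimately show "\<delta> \<in> ?F ` unfolded_vertices" by (simp only:)
  qed
qed

text \<open>Seen from the corner, each unfolded vertex lies in a single direction.\<close>

lemma countable_nongeneric_direction:
  assumes "a \<noteq> c"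
  shows "countable {s. 0 < s \<and> s < pi \<and> \<not> generic (V c) (dir c a s)}"
proof (rule countable_subset)
  let ?F = "\<lambda>q. arccos (sgn (q - V c) \<bullet> ray c a)"
  show "countable (?F ` unfolded_vertices)" using countable_unfolded by simp
  show "{s. 0 < s \<and> s < pi \<and> \<not> generic (V c) (dir c a s)} \<subseteq> ?F ` unfolded_vertices"
  proof
    fix s assume "s \<in> {s. 0 < s \<and> s < pi \<and> \<not> generic (V c) (dir c a s)}"
    then obtain L where L: "0 < L" "V c + L *\<^sub>R dir c a s \<in> unfolded_vertices" and s: "0 < s" "s < pi"
      by (auto simp: generic_def)
    have "sgn (V c + L *\<^sub>R dir c a s - V c) = dir c a s" using L(1) assms by (simp add: sgn_div_norm)
    moreover have "dir c a s \<bullet> ray c a = cos s"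
      using assms ray_orth[OF assms] by (simp add: dir_def inner_left_distrib inner_commute[of "inward_normal a"] dot_square_norm)
    ultimately have "?F (V c + L *\<^sub>R dir c a s) = s" using s by (simp add: arccos_cos)
    moreover have "?F (V c + L *\<^sub>R dir c a s) \<in> ?F ` unfolded_vertices" using L(2) by (rule imageI)
    ultimately show "s \<in> ?F ` unfolded_vertices" by (simp only:)
  qed
qed

lemma good_corner:
  assumes "a \<noteq> c" "0 < s" "s < ang c" "generic (V c) (dir c a s)"
  shows "good (V c) (dir c a s)"
proof -
  have b: "other c a \<noteq> c" "other c a \<noteq> a" using other_neq[OF assms(1)] by auto
  have "0 < inward_normal a \<bullet> dir c a s" using inward_normal_dir[OF assms(1)] assms ang_bounds[of c] by (simp add: sin_gt_zero)
  moreover have "0 < inward_normal (other c a) \<bullet> dir c a s" using inward_normal_other_dir[OF assms(1)] assms ang_bounds[of c] by (simp add: sin_gt_zero)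
  ultimately have "admissible (V c) (dir c a s)"
    unfolding admissible_def using three_cases[of a c "other c a"] b assms(1) signed_dist_self_pos signed_dist_other by metis
  then show ?thesis using assms by (simp add: good_def)
qed

end

section \<open>Gluing half-orbits at a common point\<close>

text \<open>Index 0 belongs to \<open>F\<close>, and \<open>G\<close> is read backwards from index
  -1.\<close>

definition bi_infinite :: "(nat \<Rightarrow> 'b) \<Rightarrow> (nat \<Rightarrow> 'b) \<Rightarrow> int \<Rightarrow> 'b" where
  "bi_infinite F G n = (if 0 \<le> n then F (nat n) else G (nat (- n - 1)))"

lemma bi_infinite_simps [simp]:
  "bi_infinite F G (int m) = F m" "bi_infinite F G (int m + 1) = F (Suc m)" "bi_infinite F G (1 + int m) = F (Suc m)"
  "bi_infinite F G (- 1 - int m) = G m" "bi_infinite F G 0 = F 0" "bi_infinite F G (- 1) = G 0"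
  by (simp_all add: bi_infinite_def nat_add_distrib)

lemma int_bi_infinite_cases: obtains m where "n = int m" | m where "n = - 1 - int m"
proof (cases "0 \<le> n")
  case True then show thesis using that(1)[of "nat n"] by simp
next
  case False then show thesis using that(2)[of "nat (- n - 1)"] by simp
qed

context billiard_triangle
begin

lemma reflect_add: "reflect a (x + y) = reflect a x + reflect a y"
  by (simp add: reflect_def inner_add_left algebra_simps)

lemma reflect_scale: "reflect a (r *\<^sub>R x) = r *\<^sub>R reflect a x"
  by (simp add: reflect_def algebra_simps)

lemma ipathD:
  assumes "ipath \<iota> p v h"
  shows "0 < h n" "inward_normal (\<iota> n) \<bullet> v n < 0" "p (Suc n) = p n + h n *\<^sub>R v n"
    "open_edge (\<iota> n) (p (Suc n))" "v (Suc n) = reflect (\<iota> n) (v n)"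
  using assms unfolding ipath_def by blast+

lemma ipath_norm: "ipath \<iota> p v h \<Longrightarrow> norm (v 0) = 1 \<Longrightarrow> norm (v n) = 1"
  by (induction n) (simp_all add: ipathD(5))

lemma ipath_out: "ipath \<iota> p v h \<Longrightarrow> 0 < inward_normal (\<iota> n) \<bullet> v (Suc n)"
  using ipathD(2)[of \<iota> p v h n] by (simp add: ipathD(5) inward_normal_reflect)

lemma ipath_neq: "ipath \<iota> p v h \<Longrightarrow> \<iota> (Suc n) \<noteq> \<iota> n"
  using ipath_out[of \<iota> p v h n] ipathD(2)[of \<iota> p v h "Suc n"] by auto

lemma other_pow_neq: "a \<noteq> c \<Longrightarrow> (other c ^^ j) a \<noteq> c"
  by (induction j) (simp_all add: other_neq)

lemma fan_angles:
  assumes ip: "ipath \<iota> p v h" and "a \<noteq> c" and alt: "\<And>j. j < M \<Longrightarrow> \<iota> j = (other c ^^ j) a"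
    and "v 1 = dir c a \<tau>" "0 < \<tau>" "\<tau> < pi" "j < M"
  shows "v (Suc j) = dir c ((other c ^^ j) a) (\<tau> - real j * ang c) \<and> 0 < \<tau> - real j * ang c"
  using assms(7)
proof (induction j)
  case 0 then show ?case using assms by simp
next
  case (Suc j)
  let ?x = "(other c ^^ j) a" and ?t = "\<tau> - real j * ang c"
  have x: "?x \<noteq> c" using other_pow_neq assms(2) by simp
  have IH: "v (Suc j) = dir c ?x ?t" "0 < ?t" using Suc by auto
  have i: "\<iota> (Suc j) = other c ?x" using alt[OF Suc.prems] by simp
  have e: "v (Suc (Suc j)) = dir c (other c ?x) (?t - ang c)"
    using ipathD(5)[OF ip, of "Suc j"] i IH(1) reflect_other_dir[OF x] by simp
  have "0 < sin (?t - ang c)"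
    using ipath_out[OF ip, of "Suc j"] i e inward_normal_dir[of "other c ?x" c] other_neq(2)[OF x] by simp
  \<comment> \<open>An angle above \<open>- pi\<close> whose sine is positive cannot be negative or
    0.\<close>
  moreover have "?t - ang c > - pi" using IH(2) ang_bounds[of c] by linarith
  ultimately have "0 < ?t - ang c" using sin_gt_zero[of "- (?t - ang c)"] by (smt (verit) sin_minus sin_zero)
  then show ?case using e by (simp add: algebra_simps)
qed

text \<open>While edge \<open>c\<close> is avoided, the outgoing angle at the corner \<open>c\<close> decreases by \<open>ang c\<close> at every bounce but
stays positive.\<close>

lemma ipath_all_edges:
  assumes ip: "ipath \<iota> p v h" and v: "norm (v 0) = 1" and M: "pi \<le> real M * ang c"
  shows "\<exists>j\<le>M. \<iota> j = c"
proof (rule ccontr)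
  assume "\<not> (\<exists>j\<le>M. \<iota> j = c)"
  then have nc: "\<iota> j \<noteq> c" if "j \<le> M" for j using that by blast
  have alt: "\<iota> j = (other c ^^ j) (\<iota> 0)" if "j < Suc M" for j
    using that
  proof (induction j)
    case (Suc j)
    then have "other c (\<iota> j) = \<iota> (Suc j)" by (intro other_eqI nc ipath_neq[OF ip, symmetric]) simp_all
    then show ?case using Suc by simp
  qed simp
  obtain \<tau> where \<tau>: "0 < \<tau>" "\<tau> < pi" "v (Suc 0) = dir c (\<iota> 0) \<tau>"
    using dir_exists[of "\<iota> 0" c "v (Suc 0)"] nc[of 0] ipath_norm[OF ip v] ipath_out[OF ip, of 0] by blast
  have "0 < \<tau> - real M * ang c"
    by (rule fan_angles[OF ip _ alt, THEN conjunct2]) (use nc[of 0] \<tau> in auto)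
  then show False using M \<tau>(2) by linarith
qed

section \<open>Lower bounds for the length of half-orbits\<close>

lemma ipath_dist:
  assumes ip: "ipath \<iota> p v h" and v: "norm (v 0) = 1" and "i \<le> M" "j \<le> M"
  shows "norm (p j - p i) \<le> (\<Sum>n<M. h n)"
proof -
  have *: "norm (p j - p i) \<le> (\<Sum>n<M. h n)" if ij: "i \<le> j" "j \<le> M" for i j
  proof -
    have "norm (p (i + k) - p i) \<le> (\<Sum>n\<in>{i..<i + k}. h n)" for k
    proof (induction k)
      case (Suc k)
      have e: "p (i + Suc k) - p i = (p (i + k) - p i) + h (i + k) *\<^sub>R v (i + k)" by (simp add: ipathD(3)[OF ip])
      have "norm (p (i + Suc k) - p i) \<le> norm (p (i + k) - p i) + h (i + k)"
        unfolding e using norm_triangle_ineq[of "p (i + k) - p i" "h (i + k) *\<^sub>R v (i + k)"] ipath_norm[OF ip v] ipathD(1)[OF ip, of "i + k"] by simp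
      then show ?case using Suc by simp
    qed simp
    from this[of "j - i"] have "norm (p j - p i) \<le> (\<Sum>n\<in>{i..<j}. h n)" using ij by simp
    also have "\<dots> \<le> (\<Sum>n<M. h n)"
      using ij ipathD(1)[OF ip] by (intro sum_mono2) (auto intro: less_imp_le)
    finally show ?thesis .
  qed
  show ?thesis using *[of i j] *[of j i] assms(3,4) by (cases "i \<le> j") (auto simp: norm_minus_commute)
qed

text \<open>Any \<open>M + 1\<close> consecutive bounces visit all three edges, so a short stretch
  would contain a point close to all of them. The constants serve all half-orbits at once, which
  makes the later choice of \<open>N\<close> uniform.\<close>

lemma ipath_length:
  obtains M :: nat and \<delta> :: real where "0 < \<delta>"
    "\<And>\<iota> p v h q. ipath \<iota> p v h \<Longrightarrow> norm (v 0) = 1 \<Longrightarrow> real q * \<delta> \<le> (\<Sum>n<q * M. h n)"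
proof -
  have "\<forall>c. \<exists>m::nat. pi \<le> real m * ang c"
    using ang_bounds(1) reals_Archimedean3 by (meson less_imp_le)
  then obtain m :: "3 \<Rightarrow> nat" where m: "\<And>c. pi \<le> real (m c) * ang c" by metis
  define M where "M = (\<Sum>c\<in>UNIV. m c)"
  have M: "pi \<le> real M * ang c" for c
  proof -
    have "m c \<le> M" unfolding M_def by (rule member_le_sum) auto
    then have "real (m c) * ang c \<le> real M * ang c" using ang_bounds(1)[of c] by (intro mult_right_mono) auto
    then show ?thesis using m[of c] by linarith
  qed
  \<comment> \<open>The sum of the reciprocal heights; \<open>1 / C\<close> is the inradius.\<close>
  define C where "C = (\<Sum>e\<in>UNIV. 1 / signed_dist e (V e))"
  have C: "0 < C" unfolding C_def using signed_dist_self_pos by (intro sum_pos) auto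
  have window: "1 / C \<le> (\<Sum>n<Suc M. h n)" if ip: "ipath \<iota> p v h" and v: "norm (v 0) = 1" for \<iota> p v h
  proof -
    let ?D = "\<Sum>n<Suc M. h n"
    let ?x = "p (Suc 0)"
    have le: "signed_dist e ?x \<le> ?D" for e
    proof -
      obtain j where j: "j \<le> M" "\<iota> j = e" using ipath_all_edges[OF ip v M] by blast
      have "signed_dist e (p (Suc j)) = 0" using ipathD(4)[OF ip, of j] j by (simp add: open_edge_def)
      then have "signed_dist e ?x = inward_normal e \<bullet> (?x - p (Suc j))" using signed_dist_diff[of e ?x "p (Suc j)"] by simp
      also have "\<dots> \<le> norm (?x - p (Suc j))" using norm_cauchy_schwarz[of "inward_normal e" "?x - p (Suc j)"] by simp
      also have "\<dots> \<le> ?D" using j by (intro ipath_dist[OF ip v]) auto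
      finally show ?thesis .
    qed
    have "1 = (\<Sum>e\<in>UNIV. signed_dist e ?x / signed_dist e (V e))" by (simp add: signed_dist_sum)
    also have "\<dots> \<le> (\<Sum>e\<in>UNIV. ?D * (1 / signed_dist e (V e)))"
      using le signed_dist_self_pos by (intro sum_mono) (simp add: divide_right_mono less_imp_le)
    also have "\<dots> = ?D * C" by (simp only: C_def sum_distrib_left)
    finally show ?thesis using C by (simp add: pos_divide_le_eq)
  qed
  have "real q * (1 / C) \<le> (\<Sum>n<q * Suc M. h n)" if ip: "ipath \<iota> p v h" and v: "norm (v 0) = 1" for \<iota> p v h q
  proof (induction q)
    case (Suc q)
    have "1 / C \<le> (\<Sum>n<Suc M. h (n + q * Suc M))"
      using window[OF ipath_shift[OF ip, of "q * Suc M"]] ipath_norm[OF ip v] by simp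
    moreover have "(\<Sum>n<Suc q * Suc M. h n) = (\<Sum>n<q * Suc M. h n) + (\<Sum>n<Suc M. h (n + q * Suc M))"
      using sum.nat_group[of h "Suc M" "Suc q"] sum.nat_group[of h "Suc M" q] sum.shift_bounds_nat_ivl[of h 0 "q * Suc M" "Suc M"]
      by (simp add: lessThan_atLeast0 add.commute)
    ultimately show ?case using Suc by (simp add: algebra_simps)
  qed simp
  then show thesis using that[of "1 / C" "Suc M"] C by simp
qed

lemma ipath_unbounded:
  assumes "ipath \<iota> p v h" "norm (v 0) = 1"
  shows "\<exists>N. B < (\<Sum>n<N. h n)"
proof -
  obtain M \<delta> where d: "0 < \<delta>" and l: "\<And>q. real q * \<delta> \<le> (\<Sum>n<q * M. h n)"
    using ipath_length assms by metis
  obtain q where "B < real q * \<delta>" using d reals_Archimedean3 by blast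
  then show ?thesis using l[of q] by (meson less_le_trans)
qed

text \<open>The second half-orbit is run backwards in time, so its velocities are negated and its
  step \<open>m\<close> becomes the segment starting at index \<open>- 1 - m\<close>. The common
  point receives index 0 and the letter \<open>a\<close>.\<close>

lemma glue_ipaths:
  assumes f: "ipath \<iota>f pf vf hf" and b: "ipath \<iota>b pb vb hb" and q: "pf 0 = pb 0" "open_edge a (pf 0)"
    and v: "norm (vf 0) = 1" "vf 0 = reflect a (- vb 0)" "0 < inward_normal a \<bullet> vf 0"
  shows "\<exists>p v t. orbit (bi_infinite (case_nat a \<iota>f) \<iota>b) p v t \<and> (\<forall>s. \<exists>n. t n \<le> s) \<and> (\<forall>s. \<exists>n. s < t n) \<and> t (- 1) < 0 \<and> 0 \<le> t 0"
proof -
  let ?\<iota> = "bi_infinite (case_nat a \<iota>f) \<iota>b"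
  define p where "p = bi_infinite pf (\<lambda>m. pb (Suc m))"
  define w where "w = bi_infinite vf (\<lambda>m. - vb m)"
  define t where "t = bi_infinite (\<lambda>m. \<Sum>j<m. hf j) (\<lambda>m. - (\<Sum>j<Suc m. hb j))"
  have vb0: "norm (vb 0) = 1" using v(1,2) by simp
  have nb: "inward_normal a \<bullet> vb 0 > 0" using v(3) by (simp add: v(2) inward_normal_reflect reflect_minus)
  have "open_edge (?\<iota> n) (p n) \<and> norm (w n) = 1 \<and> t n < t (n + 1) \<and>
     p (n + 1) = p n + (t (n + 1) - t n) *\<^sub>R w n \<and> inward_normal (?\<iota> (n + 1)) \<bullet> w n < 0 \<and>
     w (n + 1) = reflect (?\<iota> (n + 1)) (w n)" for n
  proof (cases rule: int_bi_infinite_cases[of n])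
    case (1 m)
    have n1: "n + 1 = int (Suc m)" using 1 by simp
    show ?thesis unfolding n1 unfolding 1 p_def w_def t_def bi_infinite_simps
      using ipathD[OF f, of m] ipath_norm[OF f v(1), of m] q(2) ipathD(4)[OF f]
      by (cases m) (simp_all del: of_nat_Suc)
  next
    case (2 m)
    show ?thesis
    proof (cases m)
      case 0
      have n1: "n + 1 = 0" "n = - 1" using 2 0 by simp_all
      show ?thesis unfolding n1 p_def w_def t_def bi_infinite_simps
        using ipathD[OF b, of 0] vb0 q nb v by simp
    next
      case (Suc k)
      have n1: "n + 1 = - 1 - int k" using 2 Suc by simp
      show ?thesis unfolding n1 unfolding 2 Suc p_def w_def t_def bi_infinite_simps
        using ipathD[OF b, of k] ipathD[OF b, of "Suc k"] ipath_norm[OF b vb0, of "Suc k"] ipath_out[OF b, of k]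
        by (simp add: reflect_minus)
    qed
  qed
  then have "orbit ?\<iota> p w t" unfolding orbit_def by blast
  moreover have "\<exists>n. t n \<le> s" for s
  proof -
    obtain N where N: "- s < (\<Sum>n<N. hb n)" using ipath_unbounded[OF b vb0] by blast
    also have "\<dots> \<le> (\<Sum>n<Suc N. hb n)" using ipathD(1)[OF b, of N] by simp
    finally have "t (- 1 - int N) \<le> s" by (simp add: t_def)
    then show ?thesis by blast
  qed
  moreover have "\<exists>n. s < t n" for s
  proof -
    obtain N where "s < (\<Sum>n<N. hf n)" using ipath_unbounded[OF f v(1)] by blast
    then have "s < t (int N)" by (simp add: t_def)
    then show ?thesis by blast
  qed
  moreover have "t (- 1) < 0" "0 \<le> t 0" using ipathD(1)[OF b, of 0] by (simp_all add: t_def)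
  ultimately show ?thesis by blast
qed

text \<open>Start on edge \<open>a\<close> at distance \<open>\<delta>\<close> from the corner.
  Forwards, the angle \<open>pi - s\<close> leads through the fan and out along the ray
  \<open>s'\<close>; backwards, the angle \<open>s\<close> follows the ray \<open>s\<close>. All
  small \<open>\<delta>\<close> give the right words, and only countably many fail to be
  generic.\<close>

lemma block_orbit:
  assumes "a \<noteq> c" "0 < s" "s < ang c" "0 < k" "s' = s + real k * ang c - pi" "0 < s'" "s' < ang c"
    and bw: "run bw (V c) (dir c a s)" and fw: "run fw (V c) (dir c ((other c ^^ k) a) s')"
  shows "\<exists>\<iota> p v t. orbit \<iota> p v t \<and> (\<forall>s. \<exists>n. t n \<le> s) \<and> (\<forall>s. \<exists>n. s < t n) \<and> t (- 1) < 0 \<and> 0 \<le> t 0 \<and>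
    (\<forall>j<k. \<iota> (int j) = (other c ^^ j) a) \<and> (\<forall>m<length fw. \<iota> (int (k + m)) = fw ! m) \<and>
    (\<forall>m<length bw. \<iota> (- 1 - int m) = bw ! m)"
proof -
  \<comment> \<open>The starting point itself is the first bounce of the fan, which leaves
    \<open>k - 1\<close> bounces.\<close>
  obtain K where K: "k = Suc K" using assms(4) by (cases k) auto
  let ?w = "map (\<lambda>j. (other c ^^ Suc j) a) [0..<K] @ fw"
  let ?q = "\<lambda>\<delta>. V c + \<delta> *\<^sub>R ray c a"
  define \<tau> where "\<tau> = pi - s"
  have t: "0 < ang c" "ang c < pi" using ang_bounds by auto
  have \<tau>: "0 < \<tau>" "\<tau> < pi" using assms(2,3) t by (auto simp: \<tau>_def)
  have e: "\<tau> - real K * ang c = ang c - s'" by (simp add: assms(5) K \<tau>_def algebra_simps)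
  \<comment> \<open>The angle \<open>ang c - s'\<close> from the edge hit last is the angle
    \<open>s'\<close> from the other side.\<close>
  have "dir c ((other c ^^ k) a) s' = dir c ((other c ^^ K) a) (ang c - s')"
    using dir_other[OF other_pow_neq[OF assms(1)], of K "ang c - s'"] by (simp add: K)
  then have "run fw (V c) (dir c ((other c ^^ K) a) (\<tau> - real K * ang c))" using fw e by simp
  moreover have "real K * ang c < \<tau>" "\<tau> < (real K + 1) * ang c"
    unfolding distrib_right using e assms(6,7) by linarith+
  ultimately have ev1: "\<forall>\<^sub>F \<delta> in at_right 0. run ?w (V c + (\<delta> * 1) *\<^sub>R ray c a) (dir c a \<tau>)"
    using assms(1) \<tau>(2) by (intro fan_run) simp_all
  \<comment> \<open>A fan without bounces: here \<open>fan_run\<close> reduces to stability of the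
    ray from the corner.\<close>
  have ev2: "\<forall>\<^sub>F \<delta> in at_right 0. run (map (\<lambda>j. (other c ^^ Suc j) a) [0..<0] @ bw) (V c + (\<delta> * 1) *\<^sub>R ray c a) (dir c a s)"
    using assms(1,2,3) t bw by (intro fan_run) auto
  define l where "l = norm (V (other c a) - V c)"
  have l: "0 < l" using V_neq[of "other c a" c] other_neq assms(1) by (simp add: l_def)
  have ev3: "\<forall>\<^sub>F \<delta> in at_right 0. \<delta> < l"
    by (rule eventually_at_rightI[of 0 l]) (use l in auto)
  from ev1 ev2 ev3 have "\<forall>\<^sub>F \<delta> in at_right 0. run ?w (?q \<delta>) (dir c a \<tau>) \<and> run bw (?q \<delta>) (dir c a s) \<and> \<delta> < l"
    by eventually_elim simp
  then obtain \<epsilon> where \<epsilon>: "0 < \<epsilon>" "\<And>\<delta>. 0 < \<delta> \<Longrightarrow> \<delta> < \<epsilon> \<Longrightarrow> run ?w (?q \<delta>) (dir c a \<tau>) \<and> run bw (?q \<delta>) (dir c a s) \<and> \<delta> < l"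
    unfolding eventually_at_right_field by blast
  let ?bad = "{\<delta>. \<not> generic (?q \<delta>) (dir c a \<tau>)} \<union> {\<delta>. \<not> generic (?q \<delta>) (dir c a s)}"
  have sn: "0 < sin s" "0 < sin \<tau>" using assms(2,3) t \<tau> by (auto intro!: sin_gt_zero)
  then have "countable ?bad" using countable_nongeneric_point[OF assms(1)] by auto
  moreover have "uncountable {0<..<\<epsilon>}" using \<epsilon>(1) by (simp add: uncountable_open_interval)
  ultimately have "\<not> {0<..<\<epsilon>} \<subseteq> ?bad" using countable_subset by blast
  then obtain \<delta> where \<delta>: "0 < \<delta>" "\<delta> < \<epsilon>" "generic (?q \<delta>) (dir c a \<tau>)" "generic (?q \<delta>) (dir c a s)" by auto
  have o: "open_edge a (?q \<delta>)" using open_edge_ray[OF assms(1) \<delta>(1)] \<epsilon>(2)[OF \<delta>(1,2)] by (simp add: l_def)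
  have gd: "good (?q \<delta>) (dir c a \<tau>)" "good (?q \<delta>) (dir c a s)"
    using admissible_open_edge[OF o] \<delta> sn assms(1) inward_normal_dir[OF assms(1)] by (simp_all add: good_def)
  obtain \<iota>f pf vf hf where
    f: "ipath \<iota>f pf vf hf" "pf 0 = ?q \<delta>" "vf 0 = dir c a \<tau>" "\<forall>n<length ?w. \<iota>f n = ?w ! n"
    using run_ipath[OF gd(1), of ?w] \<epsilon>(2)[OF \<delta>(1,2)] by blast
  obtain \<iota>b pb vb hb where
    b: "ipath \<iota>b pb vb hb" "pb 0 = ?q \<delta>" "vb 0 = dir c a s" "\<forall>n<length bw. \<iota>b n = bw ! n"
    using run_ipath[OF gd(2), of bw] \<epsilon>(2)[OF \<delta>(1,2)] by blast
  have vv: "dir c a \<tau> = reflect a (- dir c a s)"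
    by (simp add: minus_dir reflect_dir assms(1) \<tau>_def)
  let ?\<iota> = "bi_infinite (case_nat a \<iota>f) \<iota>b"
  have "\<exists>p v t. orbit ?\<iota> p v t \<and> (\<forall>s. \<exists>n. t n \<le> s) \<and> (\<forall>s. \<exists>n. s < t n) \<and> t (- 1) < 0 \<and> 0 \<le> t 0"
  proof (rule glue_ipaths[OF f(1) b(1)])
    show "pf 0 = pb 0" by (simp only: f(2) b(2))
    show "open_edge a (pf 0)" unfolding f(2) by (rule o)
    show "norm (vf 0) = 1" unfolding f(3) by (rule norm_dir[OF assms(1)])
    show "vf 0 = reflect a (- vb 0)" unfolding f(3) b(3) by (rule vv)
    show "0 < inward_normal a \<bullet> vf 0" unfolding f(3) inward_normal_dir[OF assms(1)] by (rule sn)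
  qed
  moreover have "\<forall>j<k. ?\<iota> (int j) = (other c ^^ j) a"
  proof (intro allI impI)
    fix j assume j: "j < k"
    show "?\<iota> (int j) = (other c ^^ j) a"
    proof (cases j)
      case (Suc i)
      then have "i < K" using j K by simp
      then have "\<iota>f i = (other c ^^ Suc i) a" using f(4)[rule_format, of i] by (simp add: nth_append)
      then show ?thesis unfolding bi_infinite_simps Suc by simp
    qed simp
  qed
  moreover have "\<forall>m<length fw. ?\<iota> (int (k + m)) = fw ! m"
  proof (intro allI impI)
    fix m assume "m < length fw"
    then have "\<iota>f (K + m) = fw ! m" using f(4)[rule_format, of "K + m"] by (simp add: nth_append)
    then show "?\<iota> (int (k + m)) = fw ! m" unfolding bi_infinite_simps K by simp
  qed
  moreover have "\<forall>m<length bw. ?\<iota> (- 1 - int m) = bw ! m" using b(4) by simp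
  ultimately show ?thesis by blast
qed

section \<open>Common words force close directions\<close>

lemma orbit_forward:
  assumes "orbit \<iota> p v t"
  shows "ipath (\<lambda>n. \<iota> (m + int n + 1)) (\<lambda>n. p (m + int n)) (\<lambda>n. v (m + int n)) (\<lambda>n. t (m + int n + 1) - t (m + int n))"
  unfolding ipath_def
proof
  fix n
  have s: "m + int (Suc n) = m + int n + 1" by simp
  show "0 < t (m + int n + 1) - t (m + int n) \<and> inward_normal (\<iota> (m + int n + 1)) \<bullet> v (m + int n) < 0 \<and>
     p (m + int (Suc n)) = p (m + int n) + (t (m + int n + 1) - t (m + int n)) *\<^sub>R v (m + int n) \<and>
     open_edge (\<iota> (m + int n + 1)) (p (m + int (Suc n))) \<and> v (m + int (Suc n)) = reflect (\<iota> (m + int n + 1)) (v (m + int n))"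
    unfolding s diff_gt_0_iff_gt using orbitD[OF assms, of "m + int n"] orbitD(1)[OF assms, of "m + int n + 1"] by (intro conjI)
qed

text \<open>Reflections are involutions, so the optical law survives time reversal. The velocity
  leaving \<open>p m\<close> backwards is the negative of the one arriving there,
  \<open>v (m - 1)\<close>.\<close>

lemma orbit_backward:
  assumes "orbit \<iota> p v t"
  shows "ipath (\<lambda>n. \<iota> (m - int n - 1)) (\<lambda>n. p (m - int n)) (\<lambda>n. - v (m - int n - 1)) (\<lambda>n. t (m - int n) - t (m - int n - 1))"
  unfolding ipath_def
proof
  fix n
  let ?k = "m - int n - 1"
  have s: "m - int (Suc n) = ?k" "?k + 1 = m - int n" by simp_all
  have v: "v ?k = reflect (\<iota> ?k) (v (?k - 1))" using orbitD(6)[OF assms, of "?k - 1"] by simp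
  have "inward_normal (\<iota> ?k) \<bullet> v (?k - 1) < 0" using orbitD(5)[OF assms, of "?k - 1"] by simp
  then have "inward_normal (\<iota> ?k) \<bullet> - v ?k < 0" unfolding v by (simp add: inward_normal_reflect)
  moreover have "p ?k = p (m - int n) + (t (m - int n) - t ?k) *\<^sub>R - v ?k"
  proof -
    have "p (m - int n) = p ?k + (t (m - int n) - t ?k) *\<^sub>R v ?k" using orbitD(4)[OF assms, of ?k] unfolding s(2) .
    then show ?thesis by simp
  qed
  moreover have "- v (?k - 1) = reflect (\<iota> ?k) (- v ?k)" unfolding v reflect_minus reflect_reflect ..
  moreover have "0 < t (m - int n) - t ?k" using orbitD(3)[OF assms, of ?k] unfolding s(2) by simp
  ultimately show "0 < t (m - int n) - t ?k \<and> inward_normal (\<iota> ?k) \<bullet> - v ?k < 0 \<and>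
     p (m - int (Suc n)) = p (m - int n) + (t (m - int n) - t ?k) *\<^sub>R - v ?k \<and>
     open_edge (\<iota> ?k) (p (m - int (Suc n))) \<and> - v (m - int (Suc n) - 1) = reflect (\<iota> ?k) (- v ?k)"
    using orbitD(1)[OF assms, of ?k] unfolding s(1) by (intro conjI)
qed

text \<open>\<open>S\<close> is the linear part of the common unfolding. Differences of points on the same edge are fixed by
the reflection, so translations never enter.\<close>

lemma ipath_same_word:
  assumes P: "ipath \<iota> p v h" "norm (v 0) = 1" and Q: "ipath \<kappa> q w k" "norm (w 0) = 1"
    and same: "\<And>n. n < N \<Longrightarrow> \<iota> n = \<kappa> n"
    and D: "norm (p 0 - q 0) \<le> D" "norm (p N - q N) \<le> D"
  shows "(\<Sum>n<N. h n) * norm (v 0 - w 0) \<le> 4 * D"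
proof -
  have "\<exists>S. linear S \<and> (\<forall>x. norm (S x) = norm x) \<and> S (v n) = v 0 \<and> S (w n) = w 0 \<and>
      S (p n - q n) = (p 0 - q 0) + (\<Sum>j<n. h j) *\<^sub>R v 0 - (\<Sum>j<n. k j) *\<^sub>R w 0" if "n \<le> N" for n
    using that
  proof (induction n)
    case 0
    show ?case by (rule exI[of _ "\<lambda>x. x"]) (simp add: linear_iff)
  next
    case (Suc n)
    then obtain S where S: "linear S" "\<And>x. norm (S x) = norm x" "S (v n) = v 0" "S (w n) = w 0"
      "S (p n - q n) = (p 0 - q 0) + (\<Sum>j<n. h j) *\<^sub>R v 0 - (\<Sum>j<n. k j) *\<^sub>R w 0" by auto
    let ?a = "\<iota> n"
    have a: "\<kappa> n = ?a" using same[of n] Suc by simp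
    have "inward_normal ?a \<bullet> (p (Suc n) - q (Suc n)) = 0"
      using ipathD(4)[OF P(1), of n] ipathD(4)[OF Q(1), of n] by (simp add: a open_edge_def signed_dist_diff[symmetric])
    then have f: "reflect ?a (p (Suc n) - q (Suc n)) = p (Suc n) - q (Suc n)" by (rule reflect_fixed)
    have "S (p (Suc n) - q (Suc n)) = S ((p n - q n) + h n *\<^sub>R v n - k n *\<^sub>R w n)"
      by (simp add: ipathD(3)[OF P(1)] ipathD(3)[OF Q(1)] algebra_simps)
    also have "\<dots> = S (p n - q n) + h n *\<^sub>R v 0 - k n *\<^sub>R w 0"
      by (simp only: linear_add[OF S(1)] linear_diff[OF S(1)] linear_scale[OF S(1)] S(3,4))
    also have "\<dots> = (p 0 - q 0) + (\<Sum>j<Suc n. h j) *\<^sub>R v 0 - (\<Sum>j<Suc n. k j) *\<^sub>R w 0"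
      unfolding S(5) by (simp add: scaleR_add_left)
    finally have 5: "S (p (Suc n) - q (Suc n)) = \<dots>" .
    have "linear (reflect ?a)" by (rule linearI) (simp_all add: reflect_add reflect_scale)
    then have "linear (\<lambda>x. S (reflect ?a x))" using linear_compose[OF _ S(1), of "reflect ?a"] by (simp add: o_def)
    then show ?case
      using S(2,3,4) 5 f ipathD(5)[OF P(1), of n] ipathD(5)[OF Q(1), of n] a
      by (intro exI[of _ "\<lambda>x. S (reflect ?a x)"]) simp
  qed
  from this[of N] obtain S where S: "\<And>x. norm (S x) = norm x"
    "S (p N - q N) = (p 0 - q 0) + (\<Sum>j<N. h j) *\<^sub>R v 0 - (\<Sum>j<N. k j) *\<^sub>R w 0" by auto
  define L where "L = (\<Sum>j<N. h j)"
  define L' where "L' = (\<Sum>j<N. k j)"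
  have L: "0 \<le> L" "0 \<le> L'" unfolding L_def L'_def using ipathD(1)[OF P(1)] ipathD(1)[OF Q(1)]
    by (simp_all add: sum_nonneg less_imp_le)
  have "L *\<^sub>R v 0 - L' *\<^sub>R w 0 = S (p N - q N) - (p 0 - q 0)" by (simp add: S(2) L_def L'_def)
  then have d: "norm (L *\<^sub>R v 0 - L' *\<^sub>R w 0) \<le> 2 * D"
    using norm_triangle_ineq4[of "S (p N - q N)" "p 0 - q 0"] D S(1) by simp
  \<comment> \<open>For unit vectors the two lengths differ by at most \<open>2 * D\<close> as well,
    so \<open>L'\<close> may be replaced by \<open>L\<close>; this doubles the bound.\<close>
  have "\<bar>L - L'\<bar> \<le> norm (L *\<^sub>R v 0 - L' *\<^sub>R w 0)"
    using norm_triangle_ineq3[of "L *\<^sub>R v 0" "L' *\<^sub>R w 0"] L P(2) Q(2) by simp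
  then have l: "norm ((L' - L) *\<^sub>R w 0) \<le> 2 * D" using d Q(2) by simp
  have e: "L *\<^sub>R (v 0 - w 0) = (L *\<^sub>R v 0 - L' *\<^sub>R w 0) + (L' - L) *\<^sub>R w 0" by (simp add: algebra_simps)
  have "norm (L *\<^sub>R (v 0 - w 0)) \<le> 4 * D"
    unfolding e using norm_triangle_ineq[of "L *\<^sub>R v 0 - L' *\<^sub>R w 0" "(L' - L) *\<^sub>R w 0"] d l by linarith
  then show ?thesis using L by (simp add: L_def)
qed

text \<open>Two half-orbits with a common word of unfolded length \<open>L\<close> differ in
  direction by at most \<open>4 * D / L\<close>, where \<open>D\<close> bounds the diameter; by
  \<open>ipath_length\<close> many letters mean a large \<open>L\<close>, uniformly.\<close>

lemma same_word_close:
  assumes "0 < \<eta>"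
  obtains N where "\<And>\<iota> p v h \<kappa> q w k. ipath \<iota> p v h \<Longrightarrow> norm (v 0) = 1 \<Longrightarrow> p 0 \<in> convex hull range V \<Longrightarrow>
     ipath \<kappa> q w k \<Longrightarrow> norm (w 0) = 1 \<Longrightarrow> q 0 \<in> convex hull range V \<Longrightarrow> (\<And>n. n < N \<Longrightarrow> \<iota> n = \<kappa> n) \<Longrightarrow>
     norm (v 0 - w 0) < \<eta>"
proof -
  have "bounded (convex hull range V)" by (simp add: bounded_convex_hull finite_imp_bounded)
  then obtain D where D: "\<And>x y. x \<in> convex hull range V \<Longrightarrow> y \<in> convex hull range V \<Longrightarrow> dist x y \<le> D"
    unfolding bounded_two_points by blast
  have D0: "0 \<le> D" using D[of "V 0" "V 0"] by (simp add: hull_inc)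
  obtain M \<delta> where d: "0 < \<delta>" and len: "\<And>\<iota> p v h q. ipath \<iota> p v h \<Longrightarrow> norm (v 0) = 1 \<Longrightarrow> real q * \<delta> \<le> (\<Sum>n<q * M. h n)"
    using ipath_length by metis
  obtain Q where Q: "4 * D / \<eta> < real Q * \<delta>" using d reals_Archimedean3 by blast
  have reg: "open_edge a x \<Longrightarrow> x \<in> convex hull range V" for a x
    using open_edge_frontier frontier_region by auto
  have "norm (v 0 - w 0) < \<eta>"
    if P: "ipath \<iota> p v h" "norm (v 0) = 1" "p 0 \<in> convex hull range V"
     and W: "ipath \<kappa> q w k" "norm (w 0) = 1" "q 0 \<in> convex hull range V" and same: "\<And>n. n < Q * M \<Longrightarrow> \<iota> n = \<kappa> n"
    for \<iota> p v h \<kappa> q w k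
  proof (rule ccontr)
    assume "\<not> norm (v 0 - w 0) < \<eta>"
    then have e: "\<eta> \<le> norm (v 0 - w 0)" by simp
    have pn: "p n \<in> convex hull range V" "q n \<in> convex hull range V" for n
      using P(3) W(3) reg ipathD(4)[OF P(1)] ipathD(4)[OF W(1)] by (cases n; blast)+
    let ?L = "\<Sum>n<Q * M. h n"
    have "?L * norm (v 0 - w 0) \<le> 4 * D"
      using ipath_same_word[OF P(1,2) W(1,2) same, where N = "Q * M" and D = D] D pn by (simp add: dist_norm)
    moreover have L: "4 * D / \<eta> < ?L" using Q len[OF P(1,2), of Q] by linarith
    then have "4 * D < ?L * \<eta>" using assms by (simp add: pos_divide_less_eq)
    moreover have "?L * \<eta> \<le> ?L * norm (v 0 - w 0)"
    proof (rule mult_left_mono[OF e])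
      have "0 \<le> 4 * D / \<eta>" using D0 assms by simp
      then show "0 \<le> ?L" using L by linarith
    qed
    ultimately show False by linarith
  qed
  then show thesis using that by blast
qed

end

text \<open>A short chord means a small angle, except near a full turn, where the chord is short
  again. The bound \<open>2 * pi - \<theta>\<close> together with
  \<open>\<epsilon> \<le> \<theta>\<close> excludes that case.\<close>

lemma sin_half_lt_imp:
  assumes "0 < \<epsilon>" "\<epsilon> \<le> \<theta>" "\<theta> < pi" "\<bar>x\<bar> < 2 * pi - \<theta>" "\<bar>sin (x / 2)\<bar> < sin (\<epsilon> / 2)"
  shows "\<bar>x\<bar> < \<epsilon>"
proof (rule ccontr)
  assume "\<not> \<bar>x\<bar> < \<epsilon>"
  then have x: "\<epsilon> \<le> \<bar>x\<bar>" by simp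
  define y where "y = \<bar>x\<bar> / 2"
  have y: "\<epsilon> / 2 \<le> y" "y \<le> pi - \<epsilon> / 2" using x assms by (auto simp: y_def)
  have "sin (\<epsilon> / 2) \<le> sin y"
  proof (cases "y \<le> pi / 2")
    case True
    then show ?thesis using y assms(1) by (intro sin_monotone_2pi_le) auto
  next
    case False
    then have "sin (\<epsilon> / 2) \<le> sin (pi - y)" using y assms(1) by (intro sin_monotone_2pi_le) auto
    then show ?thesis by simp
  qed
  moreover have "sin y \<le> \<bar>sin (x / 2)\<bar>" by (cases "0 \<le> x") (auto simp: y_def)
  ultimately show False using assms(5) by linarith
qed

section \<open>The rotation number of a corner\<close>

text \<open>Only words occur here and no triangle, so that a chain built in one triangle can be read
  in another.\<close>

definition fan_chain :: "3 \<Rightarrow> (nat \<Rightarrow> 3) \<Rightarrow> (nat \<Rightarrow> nat) \<Rightarrow> nat \<Rightarrow> (nat \<Rightarrow> int \<Rightarrow> 3) \<Rightarrow> bool" where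
  "fan_chain c a k N W \<longleftrightarrow> (\<forall>i. a i \<noteq> c \<and> 0 < k i \<and> a (Suc i) = (other c ^^ k i) (a i) \<and>
     (\<forall>j<k i. W i (int j) = (other c ^^ j) (a i)) \<and>
     (\<forall>m<N. W i (int (k i + m)) = W (Suc i) (- 1 - int m)))"

context billiard_triangle
begin

definition bounce_word :: "(int \<Rightarrow> 3) \<Rightarrow> bool" where
  "bounce_word \<iota> \<longleftrightarrow> (\<exists>p v t. orbit \<iota> p v t \<and> (\<forall>s. \<exists>n. t n \<le> s) \<and> (\<forall>s. \<exists>n. s < t n) \<and> t (- 1) < 0 \<and> 0 \<le> t 0)"

lemma orbit_all_edges:
  assumes "orbit \<iota> p v t"
  shows "\<exists>n. \<iota> n = c"
proof -
  obtain M :: nat where "pi \<le> real M * ang c"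
    using ang_bounds(1)[of c] reals_Archimedean3 by (meson less_imp_le)
  then show ?thesis using ipath_all_edges[OF orbit_forward[OF assms]] orbitD(2)[OF assms] by blast
qed

text \<open>Only the fan is known and not the letters around it, so the angles are bounded by
  positivity and \<open>pi\<close> alone. The arrival is read backwards in time, as the angle
  \<open>s\<close> of \<open>- v (- 1)\<close>.\<close>

lemma orbit_fan:
  assumes o: "orbit \<iota> p v t" and a: "a \<noteq> c" and k: "0 < k" and alt: "\<And>j. j < k \<Longrightarrow> \<iota> (int j) = (other c ^^ j) a"
  shows "\<exists>s. 0 < s \<and> s < pi \<and> - v (- 1) = dir c a s \<and>
    v (int k - 1) = dir c ((other c ^^ (k - 1)) a) (pi - s - real (k - 1) * ang c) \<and> 0 < pi - s - real (k - 1) * ang c"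
proof -
  have i0: "\<iota> 0 = a" using alt[OF k] by simp
  have v0: "v 0 = reflect a (v (- 1))" "inward_normal a \<bullet> v (- 1) < 0" using orbitD(5,6)[OF o, of "- 1"] i0 by simp_all
  then have "0 < inward_normal a \<bullet> v 0" by (simp add: inward_normal_reflect)
  then obtain \<tau> where \<tau>: "0 < \<tau>" "\<tau> < pi" "v 0 = dir c a \<tau>" using dir_exists[OF a] orbitD(2)[OF o] by blast
  have "- v (- 1) = - reflect a (v 0)" by (simp add: v0)
  also have "\<dots> = dir c a (pi - \<tau>)" unfolding \<tau>(3) reflect_dir[OF a] by (simp add: dir_def cos_diff sin_diff)
  finally have vm: "- v (- 1) = dir c a (pi - \<tau>)" .
  have f: "ipath (\<lambda>n. \<iota> (int n)) (\<lambda>n. p (int n - 1)) (\<lambda>n. v (int n - 1)) (\<lambda>n. t (int n) - t (int n - 1))"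
    using orbit_forward[OF o, of "- 1"] by (simp add: add.commute)
  have "v (int (Suc (k - 1)) - 1) = dir c ((other c ^^ (k - 1)) a) (\<tau> - real (k - 1) * ang c) \<and> 0 < \<tau> - real (k - 1) * ang c"
    by (rule fan_angles[OF f a alt]) (use \<tau> k in auto)
  then have "v (int k - 1) = dir c ((other c ^^ (k - 1)) a) (pi - (pi - \<tau>) - real (k - 1) * ang c) \<and> 0 < pi - (pi - \<tau>) - real (k - 1) * ang c"
    using k by (simp add: of_nat_diff)
  then show ?thesis using vm \<tau> by (intro exI[of _ "pi - \<tau>"]) simp
qed

text \<open>The words may depend on \<open>N\<close>, while \<open>a\<close> and \<open>k\<close> do
  not. For fixed \<open>n\<close> the total defect of \<open>n\<close> steps vanishes as
  \<open>N\<close> grows; what remains is the difference of two angles in the interval from 0 to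
  \<open>pi\<close>.\<close>

lemma chain_estimate:
  assumes chain: "\<And>N. \<exists>W. fan_chain c a k N W \<and> (\<forall>i. \<exists>p v t. orbit (W i) p v t)"
  shows "\<bar>real (\<Sum>i<n. k i) * ang c - real n * pi\<bar> \<le> pi"
proof -
  let ?\<theta> = "ang c"
  have t: "0 < ?\<theta>" "?\<theta> < pi" using ang_bounds by auto
  have est: "\<bar>real (\<Sum>i<n. k i) * ?\<theta> - real n * pi\<bar> \<le> pi + real n * \<epsilon>" if \<epsilon>: "0 < \<epsilon>" "\<epsilon> \<le> ?\<theta>" for \<epsilon>
  proof -
    \<comment> \<open>The chord of an arc of length \<open>\<epsilon>\<close>, as in
      \<open>dir_dist\<close>.\<close>
    define \<eta> where "\<eta> = 2 * sin (\<epsilon> / 2)"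
    have "0 < \<eta>" unfolding \<eta>_def using \<epsilon> t by (simp add: sin_gt_zero)
    then obtain N where N: "\<And>\<iota> p v h \<kappa> q w k. ipath \<iota> p v h \<Longrightarrow> norm (v 0) = 1 \<Longrightarrow> p 0 \<in> convex hull range V \<Longrightarrow>
       ipath \<kappa> q w k \<Longrightarrow> norm (w 0) = 1 \<Longrightarrow> q 0 \<in> convex hull range V \<Longrightarrow> (\<And>n. n < N \<Longrightarrow> \<iota> n = \<kappa> n) \<Longrightarrow>
       norm (v 0 - w 0) < \<eta>" using same_word_close by metis
    obtain W where W: "fan_chain c a k N W" "\<forall>i. \<exists>p v t. orbit (W i) p v t" using chain by blast
    from W(2) obtain p v u where o: "\<And>i. orbit (W i) (p i) (v i) (u i)" by metis
    have a: "a i \<noteq> c" and k: "0 < k i" and aS: "a (Suc i) = (other c ^^ k i) (a i)"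
      and fan: "j < k i \<Longrightarrow> W i (int j) = (other c ^^ j) (a i)"
      and mat: "m < N \<Longrightarrow> W i (int (k i + m)) = W (Suc i) (- 1 - int m)" for i j m
      using W(1) unfolding fan_chain_def by blast+
    have "\<forall>i. \<exists>s. 0 < s \<and> s < pi \<and> - v i (- 1) = dir c (a i) s \<and>
      v i (int (k i) - 1) = dir c ((other c ^^ (k i - 1)) (a i)) (pi - s - real (k i - 1) * ?\<theta>) \<and> 0 < pi - s - real (k i - 1) * ?\<theta>"
      using orbit_fan[OF o a k fan] by blast
    then obtain s where s: "\<And>i. 0 < s i" "\<And>i. s i < pi" "\<And>i. - v i (- 1) = dir c (a i) (s i)"
      "\<And>i. v i (int (k i) - 1) = dir c ((other c ^^ (k i - 1)) (a i)) (pi - s i - real (k i - 1) * ?\<theta>)"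
      "\<And>i. 0 < pi - s i - real (k i - 1) * ?\<theta>" by metis
    have reg: "p i m \<in> convex hull range V" for i m
      using open_edge_frontier[OF orbitD(1)[OF o, of i m]] frontier_region by auto
    have step: "\<bar>(s i + real (k i) * ?\<theta> - pi) - s (Suc i)\<bar> < \<epsilon>" for i
    proof -
      let ?x = "(other c ^^ (k i - 1)) (a i)" and ?\<tau> = "pi - s i - real (k i - 1) * ?\<theta>"
      have x: "?x \<noteq> c" using other_pow_neq[OF a] by simp
      have ax: "other c ?x = a (Suc i)" unfolding aS using k[of i] by (cases "k i") simp_all
      have f: "ipath (\<lambda>m. W i (int (k i) - 1 + int m + 1)) (\<lambda>m. p i (int (k i) - 1 + int m)) (\<lambda>m. v i (int (k i) - 1 + int m))
          (\<lambda>m. u i (int (k i) - 1 + int m + 1) - u i (int (k i) - 1 + int m))"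
        by (rule orbit_forward[OF o])
      have b: "ipath (\<lambda>m. W (Suc i) (0 - int m - 1)) (\<lambda>m. p (Suc i) (0 - int m)) (\<lambda>m. - v (Suc i) (0 - int m - 1))
          (\<lambda>m. u (Suc i) (0 - int m) - u (Suc i) (0 - int m - 1))"
        by (rule orbit_backward[OF o])
      \<comment> \<open>The path leaving fan \<open>i\<close> and the time-reversed path arriving at
        fan \<open>Suc i\<close> share \<open>N\<close> letters.\<close>
      have "norm (v i (int (k i) - 1 + int 0) - - v (Suc i) (0 - int 0 - 1)) < \<eta>"
      proof (rule N[OF f _ reg b _ reg])
        show "norm (v i (int (k i) - 1 + int 0)) = 1" "norm (- v (Suc i) (0 - int 0 - 1)) = 1"
          using orbitD(2)[OF o] by simp_all
        fix m assume "m < N"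
        then have "W i (int (k i + m)) = W (Suc i) (- 1 - int m)" by (rule mat)
        moreover have "int (k i) - 1 + int m + 1 = int (k i + m)" "0 - int m - 1 = - 1 - int m" by simp_all
        ultimately show "W i (int (k i) - 1 + int m + 1) = W (Suc i) (0 - int m - 1)" by (simp only:)
      qed
      then have "norm (dir c ?x ?\<tau> - dir c (a (Suc i)) (s (Suc i))) < \<eta>" using s(3)[of "Suc i"] s(4)[of i] by simp
      moreover have "dir c ?x ?\<tau> = dir c (a (Suc i)) (?\<theta> - ?\<tau>)" using dir_other[OF x] by (simp only: ax[symmetric])
      ultimately have "\<bar>sin ((?\<theta> - ?\<tau> - s (Suc i)) / 2)\<bar> < sin (\<epsilon> / 2)"
        using dir_dist[OF a] by (simp add: \<eta>_def)
      moreover have "0 \<le> real (k i - 1) * ?\<theta>" using t by simp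
      \<comment> \<open>Both \<open>?\<tau>\<close> and \<open>s (Suc i)\<close> lie between 0 and
        \<open>pi\<close>, which keeps the difference away from a full turn.\<close>
      then have "\<bar>?\<theta> - ?\<tau> - s (Suc i)\<bar> < 2 * pi - ?\<theta>"
        using s(1)[of i] s(5)[of i] s(1,2)[of "Suc i"] t by linarith
      ultimately have "\<bar>?\<theta> - ?\<tau> - s (Suc i)\<bar> < \<epsilon>" using sin_half_lt_imp \<epsilon> t(2) by blast
      moreover have "real (k i - 1) = real (k i) - 1" using k[of i] by (simp add: of_nat_diff)
      ultimately show ?thesis by (simp add: algebra_simps)
    qed
    have "\<bar>(s 0 + real (\<Sum>i<n. k i) * ?\<theta> - real n * pi) - s n\<bar> \<le> real n * \<epsilon>" for n
    proof (induction n)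
      case (Suc n)
      have "s 0 + real (\<Sum>i<Suc n. k i) * ?\<theta> - real (Suc n) * pi - s (Suc n)
        = (s 0 + real (\<Sum>i<n. k i) * ?\<theta> - real n * pi - s n) + ((s n + real (k n) * ?\<theta> - pi) - s (Suc n))"
        by (simp add: algebra_simps)
      then show ?case using Suc step[of n] by (simp add: distrib_right)
    qed simp
    from this[of n] show ?thesis using s(1,2)[of 0] s(1,2)[of n] by linarith
  qed
  show ?thesis
  proof (rule field_le_epsilon)
    fix e :: real assume e: "0 < e"
    define \<epsilon> where "\<epsilon> = min ?\<theta> (e / (real n + 1))"
    have \<epsilon>: "0 < \<epsilon>" "\<epsilon> \<le> ?\<theta>" using e t by (auto simp: \<epsilon>_def)
    have "real n * \<epsilon> \<le> (real n + 1) * (e / (real n + 1))" using e \<epsilon>(1) by (intro mult_mono) (auto simp: \<epsilon>_def)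
    then have "real n * \<epsilon> \<le> e" by simp
    then show "\<bar>real (\<Sum>i<n. k i) * ?\<theta> - real n * pi\<bar> \<le> pi + e" using est[OF \<epsilon>] by linarith
  qed
qed

text \<open>The fans come from an irrational-like rotation on generic angles only in the sense
  needed: every angle of the chain lies strictly inside the corner and gives a ray that meets no
  vertex. \<open>a\<close> and \<open>k\<close> are found before \<open>N\<close>.\<close>

lemma chain_exists:
  obtains a k where "\<And>N. \<exists>W. fan_chain c a k N W \<and> (\<forall>i. bounce_word (W i))"
proof -
  let ?\<theta> = "ang c"
  have t: "0 < ?\<theta>" "?\<theta> < pi" using ang_bounds by auto
  define Bad where "Bad = (\<lambda>x. {s. 0 < s \<and> s < pi \<and> \<not> generic (V c) (dir c x s)})"
  \<comment> \<open>All starting angles for which some \<open>s0 + K * ang c - n * pi\<close> is 0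
    or nongeneric on one of the two sides. Every pair \<open>K\<close>, \<open>n\<close> is
    included, since the pairs that occur depend on \<open>s0\<close>.\<close>
  define B where "B = (\<Union>K::nat. \<Union>n::nat. (\<lambda>s. s - real K * ?\<theta> + real n * pi) ` (Bad (c + 1) \<union> Bad (c + 2) \<union> {0}))"
  have "countable (Bad (c + 1))" "countable (Bad (c + 2))"
    unfolding Bad_def using countable_nongeneric_direction three_shift by blast+
  then have "countable B" unfolding B_def by auto
  moreover have "uncountable {0<..<?\<theta>}" using t by (simp add: uncountable_open_interval)
  ultimately have "\<not> {0<..<?\<theta>} \<subseteq> B" using countable_subset by blast
  then obtain s0 where "s0 \<in> {0<..<?\<theta>}" "s0 \<notin> B" by blast
  then have s0: "0 < s0" "s0 < ?\<theta>" "s0 \<notin> B" by simp_all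
  have avoid: "s0 + real K * ?\<theta> - real n * pi \<notin> Bad (c + 1) \<union> Bad (c + 2) \<union> {0}" for K n
  proof
    assume "s0 + real K * ?\<theta> - real n * pi \<in> Bad (c + 1) \<union> Bad (c + 2) \<union> {0}"
    then have "(\<lambda>s. s - real K * ?\<theta> + real n * pi) (s0 + real K * ?\<theta> - real n * pi) \<in> B"
      unfolding B_def by blast
    then show False using s0(3) by simp
  qed
  \<comment> \<open>The total number of bounces in the first \<open>n\<close> fans: the least one
    for which the angle \<open>s n\<close> is nonnegative. It is then below \<open>ang c\<close>,
    and the choice of \<open>s0\<close> excludes 0.\<close>
  define K where "K = (\<lambda>n::nat. nat \<lceil>(real n * pi - s0) / ?\<theta>\<rceil>)"
  define s where "s = (\<lambda>n. s0 + real (K n) * ?\<theta> - real n * pi)"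
  have s: "0 < s n \<and> s n < ?\<theta>" for n
  proof -
    define z where "z = (real n * pi - s0) / ?\<theta>"
    have z\<theta>: "z * ?\<theta> = real n * pi - s0" using t by (simp add: z_def)
    have "- 1 < - s0 / ?\<theta>" using s0 t by (simp add: field_simps)
    also have "- s0 / ?\<theta> \<le> z" unfolding z_def using t by (intro divide_right_mono) auto
    finally have "0 \<le> \<lceil>z\<rceil>" by linarith
    then have Kz: "real (K n) = of_int \<lceil>z\<rceil>" by (simp add: K_def z_def)
    have "z \<le> real (K n)" "real (K n) < z + 1" unfolding Kz by linarith+
    then have "z * ?\<theta> \<le> real (K n) * ?\<theta>" "real (K n) * ?\<theta> < (z + 1) * ?\<theta>" using t by (auto intro: mult_right_mono mult_strict_right_mono)
    then have "0 \<le> s n" "s n < ?\<theta>" unfolding s_def using z\<theta> by (auto simp: distrib_right)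
    moreover have "s n \<noteq> 0" unfolding s_def using avoid[of "K n" n] by blast
    ultimately show ?thesis by simp
  qed
  have KK: "K n < K (Suc n)" for n
  proof (rule ccontr)
    assume "\<not> K n < K (Suc n)"
    then have "real (K (Suc n)) * ?\<theta> \<le> real (K n) * ?\<theta>" using t by (intro mult_right_mono) auto
    then have "s (Suc n) \<le> s n - pi" by (simp add: s_def distrib_right)
    then show False using s[of n] s[of "Suc n"] t by linarith
  qed
  define k where "k = (\<lambda>n. K (Suc n) - K n)"
  have k: "0 < k n" "K (Suc n) = k n + K n" for n using KK[of n] by (auto simp: k_def)
  define a where "a = (\<lambda>n. (other c ^^ K n) (c + 1))"
  have a: "a n \<noteq> c" for n unfolding a_def using other_pow_neq three_shift by blast
  have aS: "a (Suc n) = (other c ^^ k n) (a n)" for n by (simp add: a_def k(2) funpow_add)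
  have sS: "s (Suc n) = s n + real (k n) * ?\<theta> - pi" for n by (simp add: s_def k(2) algebra_simps)
  have good: "good (V c) (dir c (a n) (s n))" for n
  proof (rule good_corner[OF a])
    have "a n = c + 1 \<or> a n = c + 2" using three_cases[of c "c + 1" "c + 2" "a n"] three_shift[of c] a[of n] by metis
    then have "s n \<notin> Bad (a n)" unfolding s_def using avoid[of "K n" n] by auto
    then show "generic (V c) (dir c (a n) (s n))" using s[of n] t by (simp add: Bad_def)
  qed (use s in auto)
  \<comment> \<open>The infinite word of each ray, chosen independently of \<open>N\<close>. Its
    initial part ends block \<open>i\<close> and, reversed, precedes the fan of block
    \<open>i + 1\<close>.\<close>
  have "\<forall>n. \<exists>U. \<forall>N. run (map U [0..<N]) (V c) (dir c (a n) (s n))"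
  proof
    fix n
    obtain \<iota> p v h where "ipath \<iota> p v h" "p 0 = V c" "v 0 = dir c (a n) (s n)" using good_ipath[OF good] by blast
    then show "\<exists>U. \<forall>N. run (map U [0..<N]) (V c) (dir c (a n) (s n))" using ipath_run by metis
  qed
  then obtain U where U: "\<And>n N. run (map (U n) [0..<N]) (V c) (dir c (a n) (s n))" by metis
  have "\<exists>W. fan_chain c a k N W \<and> (\<forall>i. bounce_word (W i))" for N
  proof -
    have "\<forall>i. \<exists>\<iota>. bounce_word \<iota> \<and> (\<forall>j<k i. \<iota> (int j) = (other c ^^ j) (a i)) \<and>
      (\<forall>m<N. \<iota> (int (k i + m)) = U (Suc i) m) \<and> (\<forall>m<N. \<iota> (- 1 - int m) = U i m)"
    proof
      fix i
      have "run (map (U (Suc i)) [0..<N]) (V c) (dir c ((other c ^^ k i) (a i)) (s (Suc i)))" using U[of "Suc i"] aS by simp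
      from block_orbit[OF a _ _ k(1) sS _ _ U this] s
      obtain \<iota> p v u where "orbit \<iota> p v u \<and> (\<forall>s. \<exists>n. u n \<le> s) \<and> (\<forall>s. \<exists>n. s < u n) \<and> u (- 1) < 0 \<and> 0 \<le> u 0"
        "\<forall>j<k i. \<iota> (int j) = (other c ^^ j) (a i)"
        "\<forall>m<N. \<iota> (int (k i + m)) = map (U (Suc i)) [0..<N] ! m" "\<forall>m<N. \<iota> (- 1 - int m) = map (U i) [0..<N] ! m"
        by (metis (no_types, lifting) diff_zero length_map length_upt)
      then show "\<exists>\<iota>. bounce_word \<iota> \<and> (\<forall>j<k i. \<iota> (int j) = (other c ^^ j) (a i)) \<and>
        (\<forall>m<N. \<iota> (int (k i + m)) = U (Suc i) m) \<and> (\<forall>m<N. \<iota> (- 1 - int m) = U i m)"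
        unfolding bounce_word_def by (intro exI[of _ \<iota>]) auto
    qed
    then obtain W where "\<And>i. bounce_word (W i) \<and> (\<forall>j<k i. W i (int j) = (other c ^^ j) (a i)) \<and>
      (\<forall>m<N. W i (int (k i + m)) = U (Suc i) m) \<and> (\<forall>m<N. W i (- 1 - int m) = U i m)" by metis
    then show ?thesis unfolding fan_chain_def using a k(1) aS by (intro exI[of _ W]) simp
  qed
  then show thesis using that by blast
qed

end

section \<open>Equality of the angles\<close>

text \<open>The same totals \<open>K n\<close> stay within bounded distance of \<open>n * pi\<close>
  after multiplication by either angle. As they are unbounded, the angles agree.\<close>

lemma angle_determined:
  assumes "billiard_triangle V" "billiard_triangle V'"
    and sub: "\<And>\<iota>. billiard_triangle.bounce_word V \<iota> \<Longrightarrow> \<exists>p v t. billiard_triangle.orbit V' \<iota> p v t"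
  shows "billiard_triangle.ang V c = billiard_triangle.ang V' c"
proof -
  interpret P: billiard_triangle V by fact
  interpret Q: billiard_triangle V' by fact
  obtain a k where ch: "\<And>N. \<exists>W. fan_chain c a k N W \<and> (\<forall>i. P.bounce_word (W i))"
    using P.chain_exists[of c] by blast
  define K where "K = (\<lambda>n. real (\<Sum>i<n. k i))"
  have "\<exists>W. fan_chain c a k N W \<and> (\<forall>i. \<exists>p v t. P.orbit (W i) p v t)" for N
    using ch[of N] unfolding P.bounce_word_def by blast
  then have eP: "\<bar>K n * P.ang c - real n * pi\<bar> \<le> pi" for n unfolding K_def by (rule P.chain_estimate)
  have "\<exists>W. fan_chain c a k N W \<and> (\<forall>i. \<exists>p v t. Q.orbit (W i) p v t)" for N
  proof -
    obtain W where "fan_chain c a k N W" "\<And>i. P.bounce_word (W i)" using ch[of N] by blast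
    then show ?thesis using sub by blast
  qed
  then have eQ: "\<bar>K n * Q.ang c - real n * pi\<bar> \<le> pi" for n unfolding K_def by (rule Q.chain_estimate)
  show ?thesis
  proof (rule ccontr)
    assume ne: "P.ang c \<noteq> Q.ang c"
    define d where "d = \<bar>P.ang c - Q.ang c\<bar>"
    have d: "0 < d" using ne by (simp add: d_def)
    \<comment> \<open>Different angles would give \<open>K n \<le> 2 * pi / d\<close> for every
      \<open>n\<close>, whereas \<open>K n * P.ang c\<close> is at least
      \<open>n * pi - pi\<close>.\<close>
    obtain n :: nat where n: "(2 * pi * P.ang c / d + pi) / pi < real n" using reals_Archimedean2 by blast
    have Kn: "0 \<le> K n" by (simp add: K_def sum_nonneg)
    have "K n * d = \<bar>K n * P.ang c - K n * Q.ang c\<bar>"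
      using Kn by (simp add: d_def right_diff_distrib[symmetric] abs_mult)
    also have "\<dots> \<le> 2 * pi" using eP[of n] eQ[of n] by linarith
    finally have "K n \<le> 2 * pi / d" using d by (simp add: pos_le_divide_eq)
    then have "K n * P.ang c \<le> 2 * pi / d * P.ang c" using P.ang_bounds(1)[of c] by (intro mult_right_mono) auto
    moreover have "2 * pi * P.ang c / d + pi < real n * pi" using n by (simp add: pos_divide_less_eq)
    ultimately show False using eP[of n] by simp
  qed
qed

section \<open>Triangles with equal angles are similar\<close>

context billiard_triangle
begin

text \<open>The factor is the ratio of two sides given by the law of sines.\<close>

lemma triangle_sides:
  assumes "a \<noteq> b" "b \<noteq> c" "a \<noteq> c"
  defines "l \<equiv> norm (V b - V c)"
  shows "0 < l" and "V b = V c + l *\<^sub>R ray c a"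
    and "V a = V c + (l * (sin (ang b) / sin (ang c + ang b))) *\<^sub>R (cos (ang c) *\<^sub>R ray c a + sin (ang c) *\<^sub>R inward_normal a)"
proof -
  have o: "other c a = b" "other c b = a" "other b a = c" "other b c = a" using assms by (auto intro: other_eqI)
  define m where "m = norm (V a - V c)"
  define n where "n = norm (V a - V b)"
  show l: "0 < l" using V_neq[of b c] assms by simp
  show Vb: "V b = V c + l *\<^sub>R ray c a" using ray_scale[of a c] assms by (simp add: o)
  have "V a = V c + m *\<^sub>R ray c b" using ray_scale[of b c] assms by (simp add: o m_def)
  then have Va: "V a = V c + m *\<^sub>R (cos (ang c) *\<^sub>R ray c a + sin (ang c) *\<^sub>R inward_normal a)"
    using ray_other(1)[of a c] assms by (simp add: o)
  have "V a = V b + n *\<^sub>R ray b c" using ray_scale[of c b] assms by (simp add: o n_def)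
  then have "V a = V b + n *\<^sub>R (cos (ang b) *\<^sub>R ray b a + sin (ang b) *\<^sub>R inward_normal a)"
    using ray_other(1)[of a b] assms by (simp add: o)
  moreover have "ray b a = - ray c a" by (simp add: ray_def o sgn_minus[symmetric])
  ultimately have Va': "V a = V c + l *\<^sub>R ray c a + n *\<^sub>R (- (cos (ang b) *\<^sub>R ray c a) + sin (ang b) *\<^sub>R inward_normal a)"
    using Vb by simp
  have r: "ray c a \<bullet> ray c a = 1" "inward_normal a \<bullet> ray c a = 0" "ray c a \<bullet> inward_normal a = 0"
    using assms ray_orth[of a c] by (auto simp: dot_square_norm inner_commute)
  have "(V a - V c) \<bullet> ray c a = m * cos (ang c)" unfolding Va by (simp add: inner_left_distrib r)
  moreover have "(V a - V c) \<bullet> ray c a = l - n * cos (ang b)" unfolding Va' by (simp add: inner_left_distrib inner_diff_left r)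
  ultimately have e1: "m * cos (ang c) = l - n * cos (ang b)" by simp
  have "(V a - V c) \<bullet> inward_normal a = m * sin (ang c)" unfolding Va by (simp add: inner_left_distrib r)
  moreover have "(V a - V c) \<bullet> inward_normal a = n * sin (ang b)" unfolding Va' by (simp add: inner_left_distrib inner_diff_left r)
  ultimately have e2: "m * sin (ang c) = n * sin (ang b)" by simp
  have "m * sin (ang c + ang b) = (m * sin (ang c)) * cos (ang b) + (m * cos (ang c)) * sin (ang b)"
    by (simp add: sin_add algebra_simps)
  also have "\<dots> = l * sin (ang b)" unfolding e1 e2 by (simp add: algebra_simps)
  finally have e: "m * sin (ang c + ang b) = l * sin (ang b)" .
  moreover have "0 < l * sin (ang b)" using l ang_bounds[of b] by (simp add: sin_gt_zero)
  ultimately have "sin (ang c + ang b) \<noteq> 0" by auto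
  then have "m = l * (sin (ang b) / sin (ang c + ang b))" using e by (simp add: field_simps)
  then show "V a = V c + (l * (sin (ang b) / sin (ang c + ang b))) *\<^sub>R (cos (ang c) *\<^sub>R ray c a + sin (ang c) *\<^sub>R inward_normal a)"
    using Va by simp
qed

end

text \<open>In the frame formed by a side and its inward normal, the vertices depend only on the
  angles and on the length of that side. Matching the frames and scaling gives the similarity; it
  reverses orientation when the triangles are oppositely oriented.\<close>

lemma similar_if_angles:
  assumes "billiard_triangle V" "billiard_triangle V'"
    and ang: "\<And>c. billiard_triangle.ang V c = billiard_triangle.ang V' c"
  obtains f where "similarity f" "f ` (convex hull range V) = convex hull range V'"
proof -
  interpret P: billiard_triangle V by fact
  interpret Q: billiard_triangle V' by fact
  define c :: 3 where "c = 0"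
  define a :: 3 where "a = c + 1"
  define b :: 3 where "b = c + 2"
  have abc: "a \<noteq> b" "b \<noteq> c" "a \<noteq> c" using three_shift[of c] by (auto simp: a_def b_def)
  define l where "l = norm (V b - V c)"
  define l' where "l' = norm (V' b - V' c)"
  define e where "e = P.ray c a"
  define n where "n = P.inward_normal a"
  define e' where "e' = Q.ray c a"
  define n' where "n' = Q.inward_normal a"
  define m where "m = sin (P.ang b) / sin (P.ang c + P.ang b)"
  have P: "0 < l" "V b = V c + l *\<^sub>R e" "V a = V c + (l * m) *\<^sub>R (cos (P.ang c) *\<^sub>R e + sin (P.ang c) *\<^sub>R n)"
    using P.triangle_sides[OF abc] by (simp_all add: l_def e_def n_def m_def)
  have Q: "0 < l'" "V' b = V' c + l' *\<^sub>R e'" "V' a = V' c + (l' * m) *\<^sub>R (cos (P.ang c) *\<^sub>R e' + sin (P.ang c) *\<^sub>R n')"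
    using Q.triangle_sides[OF abc] by (simp_all add: l'_def e'_def n'_def m_def ang)
  have en: "norm e = 1" "norm n = 1" "e \<bullet> n = 0" using abc P.ray_orth by (simp_all add: e_def n_def)
  have en': "norm e' = 1" "norm n' = 1" "e' \<bullet> n' = 0" using abc Q.ray_orth by (simp_all add: e'_def n'_def)
  have r: "e \<bullet> e = 1" "n \<bullet> n = 1" "n \<bullet> e = 0" "e' \<bullet> e' = 1" "n' \<bullet> n' = 1" "n' \<bullet> e' = 0"
    using en en' by (simp_all add: dot_square_norm inner_commute)
  define T where "T = (\<lambda>x. (l' / l) *\<^sub>R ((x \<bullet> e) *\<^sub>R e' + (x \<bullet> n) *\<^sub>R n'))"
  have lin: "linear T" unfolding T_def
    by (rule linearI) (simp_all add: inner_left_distrib algebra_simps)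
  define f where "f = (\<lambda>x. V' c + T (x - V c))"
  have "norm (T x) = (l' / l) * norm x" for x
  proof -
    let ?y = "(x \<bullet> e) *\<^sub>R e' + (x \<bullet> n) *\<^sub>R n'"
    have "(norm ?y)\<^sup>2 = (?y \<bullet> e')\<^sup>2 + (?y \<bullet> n')\<^sup>2" using en' by (rule plane_parseval)
    also have "\<dots> = (x \<bullet> e)\<^sup>2 + (x \<bullet> n)\<^sup>2" by (simp add: inner_left_distrib r en'(3))
    also have "\<dots> = (norm x)\<^sup>2" using en by (rule plane_parseval[symmetric])
    finally have "norm ?y = norm x" by (rule power2_eq_imp_eq) auto
    then show ?thesis using P(1) Q(1) by (simp add: T_def)
  qed
  then have "dist (f x) (f y) = (l' / l) * dist x y" for x y
    using linear_diff[OF lin, of "x - V c" "y - V c"] by (simp add: f_def dist_norm) (metis (no_types) linear_diff[OF lin])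
  then have sim: "similarity f" unfolding similarity_def using P(1) Q(1) by (intro exI[of _ "l' / l"]) simp
  have T0: "T 0 = 0" by (rule linear_0[OF lin])
  have Te: "T e = (l' / l) *\<^sub>R e'" "T n = (l' / l) *\<^sub>R n'" by (simp_all add: T_def r en(3) en'(3))
  have fc: "f (V c) = V' c" by (simp add: f_def T0)
  have fb: "f (V b) = V' b" using P(1) unfolding f_def P(2) Q(2) by (simp add: linear_scale[OF lin] Te)
  have fa: "f (V a) = V' a"
    using P(1) unfolding f_def P(3) Q(3)
    by (simp add: linear_scale[OF lin] linear_add[OF lin] Te algebra_simps)
  have "f (V i) = V' i" for i using three_cases[OF abc(1,2,3), of i] fa fb fc by auto
  then have "f ` range V = range V'" by (simp add: image_image)
  moreover have "f ` (convex hull S) = convex hull (f ` S)" for S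
  proof -
    have f: "f = (\<lambda>x. (V' c - T (V c)) + x) \<circ> T" by (simp add: f_def fun_eq_iff linear_diff[OF lin])
    show ?thesis unfolding f image_comp[symmetric]
      by (simp only: convex_hull_linear_image[OF lin] convex_hull_translation)
  qed
  ultimately show thesis using that sim by metis
qed

lemma similarity_compose: "similarity f \<Longrightarrow> similarity g \<Longrightarrow> similarity (f \<circ> g)"
  unfolding similarity_def
proof (elim exE conjE)
  fix c d :: real
  assume "0 < c" "\<forall>x y. dist (f x) (f y) = c * dist x y" "0 < d" "\<forall>x y. dist (g x) (g y) = d * dist x y"
  then show "\<exists>c>0. \<forall>x y. dist ((f \<circ> g) x) ((f \<circ> g) y) = c * dist x y"
    by (intro exI[of _ "c * d"]) simp
qed

lemma shape_subset:
  assumes "similarity f" "f ` region P = region Q"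
  shows "shape Q \<subseteq> shape P"
proof
  fix S assume "S \<in> shape Q"
  then obtain g where g: "similarity g" "S = g ` region Q" by (auto simp: shape_def)
  have "S = (g \<circ> f) ` region P" unfolding g(2) assms(2)[symmetric] by (rule image_comp)
  then show "S \<in> shape P" using similarity_compose[OF g(1) assms(1)] unfolding shape_def by blast
qed

section \<open>Permuting the indices of a triangle\<close>

text \<open>Vertices and labels move together, so for a bijection the labelled figure is unchanged.
  This brings two triangles with the same labels to the same \<open>edge_label\<close>.\<close>

definition relabel :: "(3 \<Rightarrow> 3) \<Rightarrow> 'a triangle \<Rightarrow> 'a triangle" where
  "relabel \<sigma> P = \<lparr>vertex = vertex P \<circ> \<sigma>, edge_label = edge_label P \<circ> \<sigma>\<rparr>"

lemma relabel_vertices: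
  assumes "bij \<sigma>"
  shows "range (vertex (relabel \<sigma> P)) = range (vertex P)"
  by (simp only: relabel_def triangle.select_convs image_comp[symmetric] bij_is_surj[OF assms])

text \<open>A permutation of the residues mod 3 keeps or reverses the cyclic order. A reversal only
  flips the direction of edges, which neither segments nor reflections notice.\<close>

lemma relabel_shift:
  assumes "bij (\<sigma> :: 3 \<Rightarrow> 3)"
  shows "(\<sigma> (i + 1) = \<sigma> i + 1 \<and> \<sigma> (i + 2) = \<sigma> i + 2) \<or> (\<sigma> (i + 1) = \<sigma> i + 2 \<and> \<sigma> (i + 2) = \<sigma> i + 1)"
proof -
  have ne: "\<sigma> (i + 1) \<noteq> \<sigma> i" "\<sigma> (i + 2) \<noteq> \<sigma> i" "\<sigma> (i + 1) \<noteq> \<sigma> (i + 2)"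
    using three_shift[of i] by (simp_all only: inj_eq[OF bij_is_inj[OF assms]] not_False_eq_True)
  have "j = \<sigma> i \<or> j = \<sigma> i + 1 \<or> j = \<sigma> i + 2" for j
    using three_cases[of "\<sigma> i" "\<sigma> i + 1" "\<sigma> i + 2" j] three_shift[of "\<sigma> i"] by metis
  from this[of "\<sigma> (i + 1)"] this[of "\<sigma> (i + 2)"] show ?thesis using ne by metis
qed

lemma relabel_edge: "bij \<sigma> \<Longrightarrow> edge (relabel \<sigma> P) i = edge P (\<sigma> i)"
  using relabel_shift[of \<sigma> i] by (auto simp: edge_def relabel_def closed_segment_commute)

lemma relabel_reflect:
  assumes "bij \<sigma>"
  shows "reflect_along (edge_direction (relabel \<sigma> P) i) u = reflect_along (edge_direction P (\<sigma> i)) u"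
proof -
  have neg: "reflect_along (- w) u = reflect_along w u" for w by (simp add: reflect_along_def)
  have "edge_direction (relabel \<sigma> P) i = edge_direction P (\<sigma> i) \<or> edge_direction (relabel \<sigma> P) i = - edge_direction P (\<sigma> i)"
    using relabel_shift[OF assms, of i] by (auto simp: edge_direction_def relabel_def)
  then show ?thesis using neg by metis
qed

lemma relabel_spectrum:
  assumes "bij \<sigma>"
  shows "bounce_spectrum P \<subseteq> bounce_spectrum (relabel \<sigma> P)"
proof
  fix b assume "b \<in> bounce_spectrum P"
  then obtain g where g: "nonsingular_trajectory P g" "is_bounce_sequence P g b" by (auto simp: bounce_spectrum_def)
  have reg: "region (relabel \<sigma> P) = region P" by (simp add: region_def relabel_vertices[OF assms])
  have "nonsingular_trajectory (relabel \<sigma> P) g"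
    using g(1) unfolding nonsingular_trajectory_def reg relabel_vertices[OF assms] relabel_edge[OF assms] relabel_reflect[OF assms]
    by meson
  moreover have "is_bounce_sequence (relabel \<sigma> P) g b"
  proof -
    have "(\<exists>i. g s \<in> edge P i \<and> x = edge_label P i) \<Longrightarrow>
        (\<exists>i. g s \<in> edge (relabel \<sigma> P) i \<and> x = edge_label (relabel \<sigma> P) i)" for s x
      unfolding relabel_edge[OF assms] using bij_is_surj[OF assms] by (auto simp: relabel_def) (metis surjD)
    then show ?thesis using g(2) unfolding is_bounce_sequence_def reg by meson
  qed
  ultimately show "b \<in> bounce_spectrum (relabel \<sigma> P)" by (auto simp: bounce_spectrum_def)
qed

section \<open>From spectra to shapes\<close>

lemma bounce_word_spectrum:
  assumes "billiard_triangle (vertex P)" "billiard_triangle.bounce_word (vertex P) \<iota>"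
  shows "edge_label P \<circ> \<iota> \<in> bounce_spectrum P"
proof -
  interpret billiard_triangle "vertex P" by fact
  show ?thesis using assms(2) orbit_realized[OF HOL.refl] unfolding bounce_word_def by blast
qed

text \<open>One bounce sequence of \<open>P\<close> already contains all its labels, so each of them
  is a label of \<open>Q\<close>. This defines \<open>\<sigma>\<close>, injective because the labels
  of \<open>P\<close> are distinct; after relabelling \<open>Q\<close>, words of indices can be
  compared directly.\<close>

lemma spectrum_determines_similarity:
  fixes P Q :: "'a triangle"
  assumes "labelled_triangle P" "labelled_triangle Q" "bounce_spectrum P \<subseteq> bounce_spectrum Q"
  obtains f where "similarity f" "f ` region P = region Q"
proof -
  interpret P: billiard_triangle "vertex P"
    using assms(1) by unfold_locales (simp add: labelled_triangle_def)
  interpret Q: billiard_triangle "vertex Q"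
    using assms(2) by unfold_locales (simp add: labelled_triangle_def)
  have injP: "inj (edge_label P)" using assms(1) by (simp add: labelled_triangle_def)
  have "\<exists>j. edge_label P i = edge_label Q j" for i
  proof -
    obtain \<iota> where w: "P.bounce_word \<iota>" using P.chain_exists by blast
    then obtain n where n: "\<iota> n = i" using P.orbit_all_edges unfolding P.bounce_word_def by blast
    have "edge_label P \<circ> \<iota> \<in> bounce_spectrum Q"
      using bounce_word_spectrum[OF P.billiard_triangle_axioms w] assms(3) by blast
    then obtain \<kappa> where "edge_label P \<circ> \<iota> = edge_label Q \<circ> \<kappa>" using Q.bounce_sequence_orbit[OF HOL.refl] by metis
    then have "edge_label P i = edge_label Q (\<kappa> n)" using n by (metis comp_apply)
    then show ?thesis by blast
  qed
  then obtain \<sigma> where \<sigma>: "\<And>i. edge_label P i = edge_label Q (\<sigma> i)" by metis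
  have "inj \<sigma>" by (rule injI) (metis \<sigma> injD[OF injP])
  then have bij: "bij \<sigma>" by (simp add: bij_def finite_UNIV_inj_surj)
  define R where "R = relabel \<sigma> Q"
  have lab: "edge_label R = edge_label P" by (simp add: R_def relabel_def fun_eq_iff \<sigma>)
  have rng: "range (vertex R) = range (vertex Q)" unfolding R_def by (rule relabel_vertices[OF bij])
  interpret R: billiard_triangle "vertex R"
    by unfold_locales (simp add: rng Q.noncollinear)
  have "\<exists>p v t. R.orbit \<iota> p v t" if w: "P.bounce_word \<iota>" for \<iota>
  proof -
    have "edge_label P \<circ> \<iota> \<in> bounce_spectrum R"
      using bounce_word_spectrum[OF P.billiard_triangle_axioms w] assms(3) relabel_spectrum[OF bij, of Q] by (auto simp: R_def)
    then obtain \<kappa> p v t where k: "R.orbit \<kappa> p v t" "edge_label P \<circ> \<iota> = edge_label P \<circ> \<kappa>"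
      using R.bounce_sequence_orbit[OF HOL.refl] lab by metis
    have "\<iota> = \<kappa>" using k(2) injP by (simp add: fun_eq_iff inj_eq)
    then show ?thesis using k(1) by blast
  qed
  then have "P.ang c = R.ang c" for c
    by (rule angle_determined[OF P.billiard_triangle_axioms R.billiard_triangle_axioms])
  then obtain f where "similarity f" "f ` (convex hull range (vertex P)) = convex hull range (vertex R)"
    using similar_if_angles[OF P.billiard_triangle_axioms R.billiard_triangle_axioms] by blast
  then show thesis using that by (simp add: region_def rng)
qed

theorem corollary5p14:
  "\<exists>reconstruct :: (int \<Rightarrow> 'a) set \<Rightarrow> (real ^ 2) set set.
     \<forall>P :: 'a triangle. labelled_triangle P \<longrightarrow> reconstruct (bounce_spectrum P) = shape P"
proof -
  have eq: "shape P = shape Q"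
    if "labelled_triangle P" "labelled_triangle Q" "bounce_spectrum P = bounce_spectrum Q" for P Q :: "'a triangle"
    using that spectrum_determines_similarity[of P Q] spectrum_determines_similarity[of Q P] shape_subset
    by (metis order_refl subset_antisym)
  \<comment> \<open>Any triangle with the given spectrum will do, by \<open>eq\<close>; on a set
    that is no spectrum of a labelled triangle the value is arbitrary.\<close>
  define rec where "rec = (\<lambda>B. shape (SOME P :: 'a triangle. labelled_triangle P \<and> bounce_spectrum P = B))"
  have "rec (bounce_spectrum P) = shape P" if P: "labelled_triangle P" for P
  proof -
    have "labelled_triangle (SOME Q. labelled_triangle Q \<and> bounce_spectrum Q = bounce_spectrum P) \<and>
        bounce_spectrum (SOME Q. labelled_triangle Q \<and> bounce_spectrum Q = bounce_spectrum P) = bounce_spectrum P"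
      by (rule someI[of _ P]) (use P in simp)
    then show ?thesis unfolding rec_def using eq P by blast
  qed
  then show ?thesis by blast
qed

end
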